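(* In the variety $\mathbb{V}(G_1,\dots,G_6)$, every finite subdirectly irreducible algebra is projective, where $G_1,\dots,G_6$ are the six finite De Morgan monoids specified in the context.
   Context: A residuated lattice (RL) is an algebra $\langle B;\cdot,\to,\wedge,\vee,e\rangle$ where $\langle B;\cdot,e\rangle$ is a commutative monoid, $\langle B;\wedge,\vee\rangle$ is a lattice and $x\cdot y\leqslant z$ iff $y\leqslant x\to z$. A Dunn monoid is an RL with distributive lattice reduct satisfying $x\leqslant x\cdot x$. An involutive residuated lattice (IRL) is an algebra $\langle A;\cdot,\wedge,\vee,\neg,e\rangle$ where $\langle A;\cdot,e\rangle$ is a commutative monoid, $\langle A;\wedge,\vee\rangle$ is a lattice, and $\neg\neg x=x$ and ($x\cdot y\leqslant z$ iff $\neg z\cdot y\leqslant\neg x$). A De Morgan monoid is an IRL with distributive lattice reduct satisfying $x\leqslant x\cdot x$. $\mathbb{V}(G_1,\dots,G_6)$ is the variety generated by $\{G_1,\dots,G_6\}$. Projectivity is meant in this variety: $E$ is projective in $\mathsf{K}$ iff $E\in\mathsf{K}$ and $E$ is a retract of each of its homomorphic pre-images in $\mathsf{K}$. Skew reflections. Let $B$ be a Dunn monoid, $B'=\{b':b\in B\}$ a disjoint copy of $B$, $\mathit{0},\mathit{1}$ distinct non-elements of $B\cup B'$, and $S=B\cup B'\cup\{\mathit{0},\mathit{1}\}$. For a suitable subset $I\subseteq B$, let $\leqslant$ be the relation on $S$ with least element $\mathit{0}$ and greatest element $\mathit{1}$ that extends the order of $B$ and satisfies, for $b,c\in B$: $b'\leqslant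 c'$ iff $c\leqslant b$; $b'\not\leqslant c$; and $b\leqslant c'$ iff $b\cdot c\in I$. (In the cases used below this is a lattice order.) The skew reflection $\mathrm{S}^{\leqslant}(B)$ is the algebra $\langle S;\cdot,\wedge,\vee,\neg,e\rangle$, where $\wedge,\vee$ are the lattice operations of $\leqslant$, $e$ is that of $B$, $\cdot$ is commutative and extends that of $B$, $a\cdot\mathit{0}=\mathit{0}$ for all $a\in S$, $a\cdot\mathit{1}=\mathit{1}$ for $a\in S\setminus\{\mathit{0}\}$, $b\cdot c'=(b\to c)'$ and $b'\cdot c'=\mathit{1}$ for $b,c\in B$, and $\neg\mathit{0}=\mathit{1}$, $\neg\mathit{1}=\mathit{0}$, $\neg b=b'$, $\neg(b')=b$. When $I=B$, $\mathrm{S}^{\leqslant}(B)$ is called the reflection $\mathrm{R}(B)$ of $B$. The Dunn monoids used (in each, $\cdot$ is commutative, $e$ is neutral, $\bot$ is the least element, $\bot\cdot x=\bot$ for all $x$, and $x\to y$ is the largest $z$ with $x\cdot z\leqslant y$): - $\mathbf{2}^+$: the chain $\bot<e$. - $S_3^+$: the chain $\bot<e<\top$, with $\top\cdot\top=\top$. - $C_4^+$: the chain $\bot<e<a<\top$, with $a\cdot a=a\cdot\top=\top\cdot\top=\top$. - $T_5$: elements $\bot,e,s,t,\top$, where $\bot<e<t<\top$, $\bot<s<t$, $e,s$ are incomparable and $t=e\vee s$; $s\cdot s=s\cdot t=s\cdot\top=s$, $t\cdot t=t$, $t\cdot\top=\top\cdot\top=\top$. - $T_6$: elements $\bot,e,s,t,u,\top$,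 where $\bot<e<t<u<\top$, $\bot<s<t$, $e,s$ are incomparable and $t=e\vee s$; $s\cdot s=s\cdot t=s\cdot u=s\cdot\top=s$, $t\cdot t=t$, $t\cdot u=u$, $t\cdot\top=u\cdot u=u\cdot\top=\top\cdot\top=\top$. $G_1=\mathrm{R}(\mathbf{2}^+)$ and $G_2=\mathrm{R}(S_3^+)$ (so $I=B$). $G_3=\mathrm{S}^{\leqslant}(S_3^+)$, $G_4=\mathrm{S}^{\leqslant}(C_4^+)$, $G_5=\mathrm{S}^{\leqslant}(T_5)$, $G_6=\mathrm{S}^{\leqslant}(T_6)$, with the order $\leqslant$ given by $I=B\setminus\{\top\}$. *)

theory Defs
  imports "HOL-Algebra.Group"
begin

section \<open>Algebras\<close>

record 'a lat_monoid = "'a monoid" +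
  inf_op :: "'a \<Rightarrow> 'a \<Rightarrow> 'a"
  sup_op :: "'a \<Rightarrow> 'a \<Rightarrow> 'a"

record 'a rl = "'a lat_monoid" +
  imp_op :: "'a \<Rightarrow> 'a \<Rightarrow> 'a"

record 'a irl = "'a lat_monoid" +
  neg_op :: "'a \<Rightarrow> 'a"

definition lat_le :: "('a, 'm) lat_monoid_scheme \<Rightarrow> 'a \<Rightarrow> 'a \<Rightarrow> bool" where
  "lat_le B x y \<longleftrightarrow> inf_op B x y = x"

abbreviation ordered_set :: "'a set \<Rightarrow> ('a \<Rightarrow> 'a \<Rightarrow> bool) \<Rightarrow> 'a gorder" where
  "ordered_set X r \<equiv> \<lparr>carrier = X, eq = (=), le = r\<rparr>"

definition irl_algebra :: "'a irl \<Rightarrow> bool" where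
  "irl_algebra A \<longleftrightarrow>
     \<one>\<^bsub>A\<^esub> \<in> carrier A \<and>
     (\<forall>x\<in>carrier A. neg_op A x \<in> carrier A) \<and>
     (\<forall>x\<in>carrier A. \<forall>y\<in>carrier A.
        x \<otimes>\<^bsub>A\<^esub> y \<in> carrier A \<and> inf_op A x y \<in> carrier A \<and> sup_op A x y \<in> carrier A)"

definition irl_hom :: "'a irl \<Rightarrow> 'b irl \<Rightarrow> ('a \<Rightarrow> 'b) set" where
  "irl_hom A B = {h \<in> hom A B.
     h \<one>\<^bsub>A\<^esub> = \<one>\<^bsub>B\<^esub> \<and>
     (\<forall>x\<in>carrier A. h (neg_op A x) = neg_op B (h x)) \<and>
     (\<forall>x\<in>carrier A. \<forall>y\<in>carrier A.
        h (inf_op A x y) = inf_op B (h x) (h y) \<and>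
        h (sup_op A x y) = sup_op B (h x) (h y))}"

definition irl_congruence :: "'a irl \<Rightarrow> ('a \<times> 'a) set \<Rightarrow> bool" where
  "irl_congruence A \<theta> \<longleftrightarrow>
     equiv (carrier A) \<theta> \<and>
     (\<forall>(x, y)\<in>\<theta>. (neg_op A x, neg_op A y) \<in> \<theta>) \<and>
     (\<forall>(x, y)\<in>\<theta>. \<forall>(u, v)\<in>\<theta>.
        (x \<otimes>\<^bsub>A\<^esub> u, y \<otimes>\<^bsub>A\<^esub> v) \<in> \<theta> \<and>
        (inf_op A x u, inf_op A y v) \<in> \<theta> \<and>
        (sup_op A x u, sup_op A y v) \<in> \<theta>)"

text \<open>The identity relation is completely meet-irreducible in the congruence lattice, where
  the meet of the empty family is the total congruence. In particular, trivial algebras are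
  not subdirectly irreducible.\<close>

definition subdirectly_irreducible :: "'a irl \<Rightarrow> bool" where
  "subdirectly_irreducible A \<longleftrightarrow>
     (\<forall>\<Theta>. (\<forall>\<theta>\<in>\<Theta>. irl_congruence A \<theta>) \<and> (carrier A \<times> carrier A) \<inter> \<Inter>\<Theta> = Id_on (carrier A)
          \<longrightarrow> Id_on (carrier A) \<in> \<Theta>)"


section \<open>Varieties\<close>

datatype irl_term =
    Var nat
  | Unit
  | Neg irl_term
  | Mult irl_term irl_term
  | Meet irl_term irl_term
  | Join irl_term irl_term

primrec eval_term :: "'a irl \<Rightarrow> (nat \<Rightarrow> 'a) \<Rightarrow> irl_term \<Rightarrow> 'a" where
  "eval_term A v (Var n) = v n"
| "eval_term A v Unit = \<one>\<^bsub>A\<^esub>"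
| "eval_term A v (Neg t) = neg_op A (eval_term A v t)"
| "eval_term A v (Mult s t) = eval_term A v s \<otimes>\<^bsub>A\<^esub> eval_term A v t"
| "eval_term A v (Meet s t) = inf_op A (eval_term A v s) (eval_term A v t)"
| "eval_term A v (Join s t) = sup_op A (eval_term A v s) (eval_term A v t)"

definition in_variety :: "(irl_term \<times> irl_term) set \<Rightarrow> 'a irl \<Rightarrow> bool" where
  "in_variety \<Sigma> A \<longleftrightarrow> irl_algebra A \<and>
     (\<forall>(s, t)\<in>\<Sigma>. \<forall>v. range v \<subseteq> carrier A \<longrightarrow> eval_term A v s = eval_term A v t)"

text \<open>Membership of \<open>A\<close> in the least variety containing \<open>K\<close>. The two element types are
  independent, so that the variety has members on every type.\<close>

definition in_generated_variety :: "'g irl set \<Rightarrow> 'a irl \<Rightarrow> bool" where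
  "in_generated_variety K A \<longleftrightarrow> (\<forall>\<Sigma>. (\<forall>G\<in>K. in_variety \<Sigma> G) \<longrightarrow> in_variety \<Sigma> A)"

text \<open>Projectivity of \<open>E\<close> in the variety generated by \<open>K\<close>: every surjective homomorphism from a
  member of the variety onto \<open>E\<close> is a retraction. HOL cannot quantify over types inside a
  formula, so the element type \<open>'b\<close> of the pre-images is a parameter; a theorem that leaves
  \<open>'b\<close> free asserts projectivity with respect to pre-images on arbitrary types.\<close>

definition projective_in_generated_variety ::
    "'b itself \<Rightarrow> 'g irl set \<Rightarrow> 'a irl \<Rightarrow> bool" where
  "projective_in_generated_variety TYPE('b) K E \<longleftrightarrow>
     in_generated_variety K E \<and>
     (\<forall>(A :: 'b irl) h.
        in_generated_variety K A \<and> h \<in> irl_hom A E \<and> h ` carrier A = carrier E \<longrightarrow>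
        (\<exists>g \<in> irl_hom E A. \<forall>x\<in>carrier E. h (g x) = x))"


section \<open>Skew reflections\<close>

datatype 'a skew = Zero | Base 'a | Copy 'a | One

text \<open>\<open>Copy b\<close> is the element \<open>b'\<close>; \<open>Zero\<close> and \<open>One\<close> are the new bounds.\<close>

fun skew_le :: "'a rl \<Rightarrow> 'a set \<Rightarrow> 'a skew \<Rightarrow> 'a skew \<Rightarrow> bool" where
  "skew_le B I Zero y \<longleftrightarrow> True"
| "skew_le B I x One \<longleftrightarrow> True"
| "skew_le B I One y \<longleftrightarrow> False"
| "skew_le B I x Zero \<longleftrightarrow> False"
| "skew_le B I (Base b) (Base c) \<longleftrightarrow> lat_le B b c"
| "skew_le B I (Base b) (Copy c) \<longleftrightarrow> b \<otimes>\<^bsub>B\<^esub> c \<in> I"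
| "skew_le B I (Copy b) (Base c) \<longleftrightarrow> False"
| "skew_le B I (Copy b) (Copy c) \<longleftrightarrow> lat_le B c b"

fun skew_mult :: "'a rl \<Rightarrow> 'a skew \<Rightarrow> 'a skew \<Rightarrow> 'a skew" where
  "skew_mult B Zero y = Zero"
| "skew_mult B x Zero = Zero"
| "skew_mult B One y = One"
| "skew_mult B x One = One"
| "skew_mult B (Base b) (Base c) = Base (b \<otimes>\<^bsub>B\<^esub> c)"
| "skew_mult B (Base b) (Copy c) = Copy (imp_op B b c)"
| "skew_mult B (Copy b) (Base c) = Copy (imp_op B c b)"
| "skew_mult B (Copy b) (Copy c) = One"

fun skew_neg :: "'a skew \<Rightarrow> 'a skew" where
  "skew_neg Zero = One"
| "skew_neg One = Zero"
| "skew_neg (Base b) = Copy b"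
| "skew_neg (Copy b) = Base b"

definition skew_carrier :: "'a set \<Rightarrow> 'a skew set" where
  "skew_carrier X = {Zero, One} \<union> Base ` X \<union> Copy ` X"

definition skew_reflection :: "'a rl \<Rightarrow> 'a set \<Rightarrow> 'a skew irl" where
  "skew_reflection B I =
     (let L = ordered_set (skew_carrier (carrier B)) (skew_le B I)
      in \<lparr>carrier = carrier L, mult = skew_mult B, one = Base \<one>\<^bsub>B\<^esub>,
          inf_op = meet L, sup_op = join L, neg_op = skew_neg\<rparr>)"

definition reflection :: "'a rl \<Rightarrow> 'a skew irl" where
  "reflection B = skew_reflection B (carrier B)"


section \<open>The generating algebras\<close>

datatype dunn_elem = bt | ee | aa | ss | tt | uu | tp

text \<open>The five Dunn monoids have carriers in the one type \<open>dunn_elem\<close> (\<open>bt\<close> and \<open>tp\<close> are the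
  bounds, \<open>ee\<close> is the identity). Their orders and multiplications agree wherever two of the
  carriers overlap, so a single order and a single multiplication table serve for all of them;
  \<open>aa\<close> never occurs together with \<open>ss\<close>, \<open>tt\<close> or \<open>uu\<close>.\<close>

definition dunn_le :: "dunn_elem \<Rightarrow> dunn_elem \<Rightarrow> bool" where
  "dunn_le x y \<longleftrightarrow> x = y \<or> x = bt \<or> y = tp \<or>
     (x, y) \<in> {(ee, aa), (ee, tt), (ee, uu), (ss, tt), (ss, uu), (tt, uu)}"

fun dunn_mult :: "dunn_elem \<Rightarrow> dunn_elem \<Rightarrow> dunn_elem" where
  "dunn_mult bt y = bt"
| "dunn_mult x bt = bt"
| "dunn_mult ee y = y"
| "dunn_mult x ee = x"
| "dunn_mult ss y = ss"
| "dunn_mult x ss = ss"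
| "dunn_mult tt tt = tt"
| "dunn_mult tt uu = uu"
| "dunn_mult uu tt = uu"
| "dunn_mult x y = tp"

definition dunn_on :: "dunn_elem set \<Rightarrow> dunn_elem rl" where
  "dunn_on X =
     (let L = ordered_set X dunn_le
      in \<lparr>carrier = X, mult = dunn_mult, one = ee, inf_op = meet L, sup_op = join L,
          imp_op = (\<lambda>x y. THE z. greatest L z {w \<in> X. dunn_le (dunn_mult x w) y})\<rparr>)"

definition two_plus :: "dunn_elem rl" where "two_plus = dunn_on {bt, ee}"
definition S3_plus :: "dunn_elem rl" where "S3_plus = dunn_on {bt, ee, tp}"
definition C4_plus :: "dunn_elem rl" where "C4_plus = dunn_on {bt, ee, aa, tp}"
definition T5 :: "dunn_elem rl" where "T5 = dunn_on {bt, ee, ss, tt, tp}"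
definition T6 :: "dunn_elem rl" where "T6 = dunn_on {bt, ee, ss, tt, uu, tp}"

definition G1 :: "dunn_elem skew irl" where "G1 = reflection two_plus"
definition G2 :: "dunn_elem skew irl" where "G2 = reflection S3_plus"
definition G3 :: "dunn_elem skew irl" where
  "G3 = skew_reflection S3_plus (carrier S3_plus - {tp})"
definition G4 :: "dunn_elem skew irl" where
  "G4 = skew_reflection C4_plus (carrier C4_plus - {tp})"
definition G5 :: "dunn_elem skew irl" where
  "G5 = skew_reflection T5 (carrier T5 - {tp})"
definition G6 :: "dunn_elem skew irl" where
  "G6 = skew_reflection T6 (carrier T6 - {tp})"

end

theory Submission
  imports Defs
begin

text \<open>
  Collapsing \<open>B\<close> to \<open>e\<close> and \<open>B'\<close> to \<open>e'\<close> is a homomorphism from each \<open>G\<^sub>i\<close> to each \<open>G\<^sub>j\<close> with image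
  the subalgebra \<open>C = {0, e, e', 1}\<close> of constants, and the equivalence \<open>(x \<leftrightarrow> y) \<and> e\<close> takes only
  the values \<open>e\<close> (if \<open>x = y\<close>), \<open>\<bottom>\<close> (if \<open>x \<noteq> y\<close> collapse to the same element) and \<open>0\<close>. In a
  subdirectly irreducible member \<open>E\<close> of the variety, \<open>e\<close> is join-prime, because \<open>a \<le> e\<close> gives the
  congruence \<open>a x = a y\<close>; for finite \<open>E\<close> it follows as in Jonsson's lemma that \<open>E\<close> is a quotient of
  a subalgebra of some \<open>G\<^sub>i\<close>.

  Hence either \<open>E\<close> is generated by \<open>e\<close>, and then a section is determined by the constants, or \<open>E\<close>
  is isomorphic to \<open>G\<^sub>i\<close>, which is generated by \<open>\<bottom>\<close>. In the latter case there is a unary term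
  \<open>P\<close> with \<open>P(\<bottom>) = \<bottom>\<close> in \<open>G\<^sub>i\<close> that takes no values except \<open>e\<close> and \<open>\<bottom>\<close> in \<open>G\<^sub>i\<close>, and only the
  value \<open>e\<close> in the other \<open>G\<^sub>j\<close>. If \<open>a\<close> is mapped to \<open>\<bottom>\<close> by a surjection onto \<open>E\<close>, then \<open>P(a)\<close> satisfies every equation that \<open>\<bottom>\<close>
  satisfies in \<open>G\<^sub>i\<close>, so \<open>\<bottom> \<mapsto> P(a)\<close> extends to a section.
\<close>

section \<open>Explicit operations of the generating algebras\<close>

text \<open>The seven elements form one residuated lattice, of which all the carriers except
  \<open>{bt, ee}\<close> are subalgebras; there residuals must be cut off at \<open>ee\<close>.\<close>

definition dunn_inf :: "dunn_elem \<Rightarrow> dunn_elem \<Rightarrow> dunn_elem" where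
  "dunn_inf x y =
     (if dunn_le x y then x else if dunn_le y x then y else if x = ss \<or> y = ss then bt else ee)"

definition dunn_sup :: "dunn_elem \<Rightarrow> dunn_elem \<Rightarrow> dunn_elem" where
  "dunn_sup x y =
     (if dunn_le x y then y else if dunn_le y x then x else if aa \<in> {x, y} then tp else tt)"

text \<open>The list is a descending linear extension of the order, so the first element found is the
  residual.\<close>

definition dunn_imp :: "dunn_elem \<Rightarrow> dunn_elem \<Rightarrow> dunn_elem" where
  "dunn_imp x y =
     (case filter (\<lambda>z. dunn_le (dunn_mult x z) y) [tp, uu, tt, aa, ss, ee, bt] of
        [] \<Rightarrow> bt | z # _ \<Rightarrow> z)"

section \<open>The seven-element lattice with its product and residual\<close>

lemma dunn_le_refl [simp]: "dunn_le x x"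
  and dunn_le_bt [simp]: "dunn_le bt x"
  by (simp_all add: dunn_le_def)

lemma dunn_le_antisym: "dunn_le x y \<Longrightarrow> dunn_le y x \<Longrightarrow> x = y"
  by (cases x; cases y; simp add: dunn_le_def)

lemma dunn_le_trans: "dunn_le x y \<Longrightarrow> dunn_le y z \<Longrightarrow> dunn_le x z"
  by (cases x; cases y; simp add: dunn_le_def; cases z; simp add: dunn_le_def)

lemma dunn_le_inf_iff: "dunn_le z (dunn_inf x y) \<longleftrightarrow> dunn_le z x \<and> dunn_le z y"
  by (cases x; cases y; simp add: dunn_inf_def dunn_le_def; cases z; simp)

lemma dunn_sup_le_iff: "dunn_le (dunn_sup x y) z \<longleftrightarrow> dunn_le x z \<and> dunn_le y z"
  by (cases x; cases y; simp add: dunn_sup_def dunn_le_def; cases z; simp)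

lemma dunn_le_iff_inf: "dunn_le x y \<longleftrightarrow> dunn_inf x y = x"
  by (metis dunn_le_inf_iff dunn_le_refl dunn_inf_def)

lemma dunn_mult_comm: "dunn_mult x y = dunn_mult y x"
  by (cases x; cases y; simp)

lemma dunn_le_imp_iff: "dunn_le z (dunn_imp x y) \<longleftrightarrow> dunn_le (dunn_mult x z) y"
  by (cases x; cases y; simp add: dunn_imp_def dunn_le_def; cases z; simp)

text \<open>\<open>meet\<close> is a Hilbert choice among greatest lower bounds, so its value is
  known only once antisymmetry makes that bound unique.\<close>

lemma meet_ordered_set_eq:
  assumes anti: "\<And>x y. x \<in> X \<Longrightarrow> y \<in> X \<Longrightarrow> r x y \<Longrightarrow> r y x \<Longrightarrow> x = y"
    and "x \<in> X" "y \<in> X" "z \<in> X"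
    and glb: "\<And>w. w \<in> X \<Longrightarrow> r w z \<longleftrightarrow> r w x \<and> r w y"
    and refl: "r z z"
  shows "meet (ordered_set X r) x y = z"
  unfolding meet_def inf_def
proof (rule some_equality)
  show "greatest (ordered_set X r) z (Lower (ordered_set X r) {x, y})"
    using assms by (auto simp: greatest_def Lower_def)
  fix u assume "greatest (ordered_set X r) u (Lower (ordered_set X r) {x, y})"
  then have "u \<in> X" "r u x" "r u y" "r z u"
    using assms by (auto simp: greatest_def Lower_def)
  then show "u = z" using anti glb \<open>z \<in> X\<close> by blast
qed

lemma join_ordered_set_eq:
  assumes anti: "\<And>x y. x \<in> X \<Longrightarrow> y \<in> X \<Longrightarrow> r x y \<Longrightarrow> r y x \<Longrightarrow> x = y"
    and "x \<in> X" "y \<in> X" "z \<in> X"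
    and lub: "\<And>w. w \<in> X \<Longrightarrow> r z w \<longleftrightarrow> r x w \<and> r y w"
    and refl: "r z z"
  shows "join (ordered_set X r) x y = z"
  unfolding join_def sup_def
proof (rule some_equality)
  show "least (ordered_set X r) z (Upper (ordered_set X r) {x, y})"
    using assms by (auto simp: least_def Upper_def)
  fix u assume "least (ordered_set X r) u (Upper (ordered_set X r) {x, y})"
  then have "u \<in> X" "r x u" "r y u" "r u z"
    using assms by (auto simp: least_def Upper_def)
  then show "u = z" using anti lub \<open>z \<in> X\<close> by blast
qed

text \<open>If \<open>I\<close> consists of the elements below \<open>m\<close>, then
  \<open>b \<le> c'\<close> means \<open>b \<cdot> c \<le> m\<close>, that is,
  \<open>b \<le> c \<rightarrow> m\<close>. Since no copy lies below an element of \<open>B\<close>,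
  the mixed meet is \<open>b \<and> (c \<rightarrow> m)\<close>.\<close>

fun skew_inf :: "dunn_elem \<Rightarrow> dunn_elem skew \<Rightarrow> dunn_elem skew \<Rightarrow> dunn_elem skew" where
  "skew_inf m Zero y = Zero"
| "skew_inf m x Zero = Zero"
| "skew_inf m One y = y"
| "skew_inf m x One = x"
| "skew_inf m (Base b) (Base c) = Base (dunn_inf b c)"
| "skew_inf m (Base b) (Copy c) = Base (dunn_inf b (dunn_imp c m))"
| "skew_inf m (Copy b) (Base c) = Base (dunn_inf c (dunn_imp b m))"
| "skew_inf m (Copy b) (Copy c) = Copy (dunn_sup b c)"

definition skew_sup :: "dunn_elem \<Rightarrow> dunn_elem skew \<Rightarrow> dunn_elem skew \<Rightarrow> dunn_elem skew" where
  "skew_sup m x y = skew_neg (skew_inf m (skew_neg x) (skew_neg y))"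

fun skew_times :: "dunn_elem \<Rightarrow> dunn_elem skew \<Rightarrow> dunn_elem skew \<Rightarrow> dunn_elem skew" where
  "skew_times T Zero y = Zero"
| "skew_times T x Zero = Zero"
| "skew_times T One y = One"
| "skew_times T x One = One"
| "skew_times T (Base b) (Base c) = Base (dunn_mult b c)"
| "skew_times T (Base b) (Copy c) = Copy (dunn_inf T (dunn_imp b c))"
| "skew_times T (Copy b) (Base c) = Copy (dunn_inf T (dunn_imp c b))"
| "skew_times T (Copy b) (Copy c) = One"

text \<open>\<open>T\<close> is the greatest element of \<open>X\<close>, and the subset \<open>I\<close> of the skew reflection is the set of
  elements below \<open>m\<close>.\<close>

definition skew_model :: "dunn_elem set \<Rightarrow> dunn_elem \<Rightarrow> dunn_elem \<Rightarrow> dunn_elem skew irl" where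
  "skew_model X T m =
     \<lparr>carrier = skew_carrier X, mult = skew_times T, one = Base ee,
      inf_op = skew_inf m, sup_op = skew_sup m, neg_op = skew_neg\<rparr>"

lemma skew_model_simps [simp]:
  "carrier (skew_model X T m) = skew_carrier X"
  "mult (skew_model X T m) = skew_times T"
  "one (skew_model X T m) = Base ee"
  "inf_op (skew_model X T m) = skew_inf m"
  "sup_op (skew_model X T m) = skew_sup m"
  "neg_op (skew_model X T m) = skew_neg"
  by (simp_all add: skew_model_def)

definition skew_params :: "dunn_elem set \<Rightarrow> dunn_elem \<Rightarrow> dunn_elem \<Rightarrow> bool" where
  "skew_params X T m \<longleftrightarrow>
     {bt, ee, T, m} \<subseteq> X \<and> dunn_le ee m \<and> (\<forall>x\<in>X. dunn_le x T) \<and>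
     (\<forall>x\<in>X. \<forall>y\<in>X. dunn_mult x y \<in> X \<and> dunn_inf x y \<in> X \<and> dunn_sup x y \<in> X \<and>
        dunn_inf T (dunn_imp x y) \<in> X)"

text \<open>Equality of records would be too strong: outside the carrier, the choice operators
  behind a skew reflection have no known value. Identities see only the carrier.\<close>

definition irl_agree :: "'a irl \<Rightarrow> 'a irl \<Rightarrow> bool" where
  "irl_agree A B \<longleftrightarrow> carrier A = carrier B \<and> \<one>\<^bsub>A\<^esub> = \<one>\<^bsub>B\<^esub> \<and>
     (\<forall>x\<in>carrier A. neg_op A x = neg_op B x) \<and>
     (\<forall>x\<in>carrier A. \<forall>y\<in>carrier A. x \<otimes>\<^bsub>A\<^esub> y = x \<otimes>\<^bsub>B\<^esub> y \<and>
        inf_op A x y = inf_op B x y \<and> sup_op A x y = sup_op B x y)"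

lemma skew_carrier_simps [simp]:
  "Zero \<in> skew_carrier X" "One \<in> skew_carrier X"
  "Base b \<in> skew_carrier X \<longleftrightarrow> b \<in> X" "Copy b \<in> skew_carrier X \<longleftrightarrow> b \<in> X"
  by (auto simp: skew_carrier_def)

lemma skew_neg_carrier [simp]: "skew_neg x \<in> skew_carrier X \<longleftrightarrow> x \<in> skew_carrier X"
  by (cases x) auto

lemma skew_neg_neg [simp]: "skew_neg (skew_neg x) = x"
  by (cases x) auto

context
  fixes X T m
  assumes params: "skew_params X T m"
begin

lemma dunn_inf_imp_in: "x \<in> X \<Longrightarrow> y \<in> X \<Longrightarrow> z \<in> X \<Longrightarrow> dunn_inf z (dunn_imp x y) \<in> X"
proof -
  assume a: "x \<in> X" "y \<in> X" "z \<in> X"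
  have "dunn_inf z (dunn_imp x y) = dunn_inf z (dunn_inf T (dunn_imp x y))"
  proof (rule dunn_le_antisym)
    have lower: "dunn_le (dunn_inf u v) u" "dunn_le (dunn_inf u v) v" for u v
      using dunn_le_inf_iff[of "dunn_inf u v" u v] by simp_all
    have "dunn_le z T" using a params by (simp add: skew_params_def)
    then show "dunn_le (dunn_inf z (dunn_imp x y)) (dunn_inf z (dunn_inf T (dunn_imp x y)))"
      using lower dunn_le_trans by (simp add: dunn_le_inf_iff) blast
    show "dunn_le (dunn_inf z (dunn_inf T (dunn_imp x y))) (dunn_inf z (dunn_imp x y))"
      using lower dunn_le_trans by (simp add: dunn_le_inf_iff) blast
  qed
  then show ?thesis using a params by (simp add: skew_params_def)
qed

lemma skew_model_closed:
  assumes "x \<in> skew_carrier X" "y \<in> skew_carrier X"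
  shows "skew_times T x y \<in> skew_carrier X" "skew_inf m x y \<in> skew_carrier X"
    "skew_sup m x y \<in> skew_carrier X"
proof -
  have inf: "skew_inf m u v \<in> skew_carrier X"
    if "u \<in> skew_carrier X" "v \<in> skew_carrier X" for u v
    using that params by (cases u; cases v) (auto simp: dunn_inf_imp_in skew_params_def)
  show "skew_inf m x y \<in> skew_carrier X" "skew_sup m x y \<in> skew_carrier X"
    using assms inf by (auto simp: skew_sup_def)
  show "skew_times T x y \<in> skew_carrier X"
    using assms params by (cases x; cases y) (auto simp: dunn_inf_imp_in skew_params_def)
qed

lemma meet_dunn:
  assumes "x \<in> X" "y \<in> X"
  shows "meet (ordered_set X dunn_le) x y = dunn_inf x y"
  using assms params
  by (intro meet_ordered_set_eq) (auto simp: dunn_le_inf_iff skew_params_def intro: dunn_le_antisym)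

lemma lat_le_dunn_on:
  assumes "x \<in> X" "y \<in> X"
  shows "lat_le (dunn_on X) x y \<longleftrightarrow> dunn_le x y"
  using meet_dunn[OF assms] by (simp add: lat_le_def dunn_on_def Let_def dunn_le_iff_inf)

text \<open>All of \<open>X\<close> lies below \<open>T\<close>, so cutting the seven-element
  residual off at \<open>T\<close> loses no candidate.\<close>

lemma imp_dunn_on:
  assumes "x \<in> X" "y \<in> X"
  shows "imp_op (dunn_on X) x y = dunn_inf T (dunn_imp x y)"
proof -
  have le: "dunn_le w (dunn_inf T (dunn_imp x y)) \<longleftrightarrow> dunn_le (dunn_mult x w) y"
    if "w \<in> X" for w
    using that params by (auto simp: dunn_le_inf_iff dunn_le_imp_iff skew_params_def)
  have inX: "dunn_inf T (dunn_imp x y) \<in> X"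
    using assms params by (simp add: skew_params_def)
  have "greatest (ordered_set X dunn_le) z {w \<in> X. dunn_le (dunn_mult x w) y}
     \<longleftrightarrow> z = dunn_inf T (dunn_imp x y)" for z
  proof
    assume g: "greatest (ordered_set X dunn_le) z {w \<in> X. dunn_le (dunn_mult x w) y}"
    then have "z \<in> X" "dunn_le (dunn_mult x z) y" by (auto simp: greatest_def)
    then have "dunn_le z (dunn_inf T (dunn_imp x y))" using le by blast
    moreover have "dunn_le (dunn_inf T (dunn_imp x y)) z"
      using g inX le[OF inX] by (auto simp: greatest_def)
    ultimately show "z = dunn_inf T (dunn_imp x y)" by (rule dunn_le_antisym)
  next
    assume z: "z = dunn_inf T (dunn_imp x y)"
    show "greatest (ordered_set X dunn_le) z {w \<in> X. dunn_le (dunn_mult x w) y}"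
      unfolding z using inX le[OF inX] le by (fastforce simp: greatest_def)
  qed
  then show ?thesis by (simp add: dunn_on_def Let_def)
qed

abbreviation (input) "sle \<equiv> skew_le (dunn_on X) {x \<in> X. dunn_le x m}"

lemma skew_le_Base_Copy:
  "b \<in> X \<Longrightarrow> c \<in> X \<Longrightarrow> sle (Base b) (Copy c) \<longleftrightarrow> dunn_le b (dunn_imp c m)"
  using params
  by (auto simp: dunn_on_def Let_def dunn_le_imp_iff dunn_mult_comm skew_params_def)

lemma skew_le_refl: "x \<in> skew_carrier X \<Longrightarrow> sle x x"
  by (cases x) (auto simp: lat_le_dunn_on)

lemma skew_le_antisym:
  "x \<in> skew_carrier X \<Longrightarrow> y \<in> skew_carrier X \<Longrightarrow> sle x y \<Longrightarrow> sle y x \<Longrightarrow> x = y"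
  by (cases x; cases y) (auto simp: lat_le_dunn_on intro: dunn_le_antisym)

lemma skew_le_neg:
  "x \<in> skew_carrier X \<Longrightarrow> y \<in> skew_carrier X \<Longrightarrow>
     sle (skew_neg x) (skew_neg y) \<longleftrightarrow> sle y x"
  by (cases x; cases y) (auto simp: dunn_on_def Let_def dunn_mult_comm)

lemma skew_le_inf_iff:
  assumes "x \<in> skew_carrier X" "y \<in> skew_carrier X" "w \<in> skew_carrier X"
  shows "sle w (skew_inf m x y) \<longleftrightarrow> sle w x \<and> sle w y"
proof -
  have cl: "dunn_inf b c \<in> X" "dunn_sup b c \<in> X" if "b \<in> X" "c \<in> X" for b c
    using that params by (auto simp: skew_params_def)
  \<comment> \<open>The order form of \<open>(c \<or> d) \<rightarrow> m = (c \<rightarrow> m)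
    \<and> (d \<rightarrow> m)\<close>, for an element of \<open>B\<close> below the meet of two
    copies.\<close>
  have sup: "dunn_le b (dunn_imp (dunn_sup c d) m)
      \<longleftrightarrow> dunn_le b (dunn_imp c m) \<and> dunn_le b (dunn_imp d m)" for b c d
    by (metis dunn_le_imp_iff dunn_mult_comm dunn_sup_le_iff)
  show ?thesis
    using assms params
    by (cases w; cases x; cases y)
       (auto simp: lat_le_dunn_on skew_le_Base_Copy dunn_le_inf_iff dunn_sup_le_iff cl
          dunn_inf_imp_in sup skew_params_def simp del: skew_le.simps(11))
qed

lemma skew_reflection_agree:
  "irl_agree (skew_reflection (dunn_on X) {x \<in> X. dunn_le x m}) (skew_model X T m)"
proof -
  let ?L = "ordered_set (skew_carrier X) sle"
  have meet: "meet ?L x y = skew_inf m x y"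
    if "x \<in> skew_carrier X" "y \<in> skew_carrier X" for x y
    using that
    by (intro meet_ordered_set_eq)
       (auto simp: skew_le_inf_iff skew_model_closed skew_le_refl intro: skew_le_antisym)
  have join: "join ?L x y = skew_sup m x y"
    if xy: "x \<in> skew_carrier X" "y \<in> skew_carrier X" for x y
  proof (intro join_ordered_set_eq)
    fix w assume w: "w \<in> skew_carrier X"
    \<comment> \<open>Negation reverses the order, which reduces joins to meets.\<close>
    have "sle (skew_sup m x y) w
      \<longleftrightarrow> sle (skew_neg w) (skew_inf m (skew_neg x) (skew_neg y))"
      using xy w skew_le_neg[of w "skew_sup m x y"] by (simp add: skew_model_closed skew_sup_def)
    also have "\<dots> \<longleftrightarrow> sle x w \<and> sle y w"
      using xy w by (simp add: skew_le_inf_iff skew_le_neg)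
    finally show "sle (skew_sup m x y) w \<longleftrightarrow> sle x w \<and> sle y w" .
  qed (use xy in \<open>auto simp: skew_model_closed skew_le_refl intro: skew_le_antisym\<close>)
  have mult: "skew_mult (dunn_on X) x y = skew_times T x y"
    if "x \<in> skew_carrier X" "y \<in> skew_carrier X" for x y
    using that by (cases x; cases y) (auto simp: imp_dunn_on, auto simp: dunn_on_def Let_def)
  show ?thesis
    by (simp add: irl_agree_def skew_reflection_def Let_def dunn_on_def
        meet[unfolded dunn_on_def Let_def, simplified]
        join[unfolded dunn_on_def Let_def, simplified] mult[unfolded dunn_on_def Let_def, simplified])
qed

end

lemma irl_algebra_skew_model: "skew_params X T m \<Longrightarrow> irl_algebra (skew_model X T m)"
  by (auto simp: irl_algebra_def skew_model_closed) (auto simp: skew_params_def)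

lemma eval_term_in_carrier:
  assumes "irl_algebra A" "range v \<subseteq> carrier A"
  shows "eval_term A v t \<in> carrier A"
  using assms by (induction t) (auto simp: irl_algebra_def)

lemma irl_agree_sym: "irl_agree A B \<Longrightarrow> irl_agree B A"
  by (auto simp: irl_agree_def)

lemma irl_agree_algebra: "irl_agree A B \<Longrightarrow> irl_algebra A \<Longrightarrow> irl_algebra B"
  by (auto simp: irl_agree_def irl_algebra_def)

lemma irl_agree_eval_term:
  assumes "irl_agree A B" "irl_algebra A" "range v \<subseteq> carrier A"
  shows "eval_term A v t = eval_term B v t"
proof (induction t)
  case (Mult s t)
  then show ?case using assms eval_term_in_carrier[OF assms(2,3)] unfolding irl_agree_def
    by (metis eval_term.simps(4))
next
  case (Meet s t)
  then show ?case using assms eval_term_in_carrier[OF assms(2,3)] unfolding irl_agree_def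
    by (metis eval_term.simps(5))
next
  case (Join s t)
  then show ?case using assms eval_term_in_carrier[OF assms(2,3)] unfolding irl_agree_def
    by (metis eval_term.simps(6))
next
  case (Neg t)
  then show ?case using assms eval_term_in_carrier[OF assms(2,3)] unfolding irl_agree_def
    by (metis eval_term.simps(3))
qed (use assms in \<open>auto simp: irl_agree_def\<close>)

lemma irl_agree_in_variety:
  assumes "irl_agree A B"
  shows "in_variety \<Sigma> A \<longleftrightarrow> in_variety \<Sigma> B"
proof -
  have "in_variety \<Sigma> D" if "irl_agree C D" "in_variety \<Sigma> C" for C D :: "'a irl"
    using that irl_agree_algebra[OF that(1)] irl_agree_eval_term[OF that(1)]
    by (fastforce simp: in_variety_def irl_agree_def)
  then show ?thesis using assms irl_agree_sym by blast
qed

text \<open>\<open>I = B\<close> is given by taking for \<open>m\<close> the greatest element, and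
  \<open>I = B - {tp}\<close> by taking the greatest of the elements other than
  \<open>tp\<close>.\<close>

definition "M1 = skew_model {bt, ee} ee ee"
definition "M2 = skew_model {bt, ee, tp} tp tp"
definition "M3 = skew_model {bt, ee, tp} tp ee"
definition "M4 = skew_model {bt, ee, aa, tp} tp aa"
definition "M5 = skew_model {bt, ee, ss, tt, tp} tp tt"
definition "M6 = skew_model {bt, ee, ss, tt, uu, tp} tp uu"

definition "models = {M1, M2, M3, M4, M5, M6}"

lemmas M_defs = M1_def M2_def M3_def M4_def M5_def M6_def

lemmas dunn_op_defs = dunn_le_def dunn_inf_def dunn_sup_def dunn_imp_def

lemma skew_params_models:
  "skew_params {bt, ee} ee ee"
  "skew_params {bt, ee, tp} tp tp"
  "skew_params {bt, ee, tp} tp ee"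
  "skew_params {bt, ee, aa, tp} tp aa"
  "skew_params {bt, ee, ss, tt, tp} tp tt"
  "skew_params {bt, ee, ss, tt, uu, tp} tp uu"
  by (simp_all add: skew_params_def dunn_op_defs)

lemma models_cases:
  assumes "G \<in> models"
  obtains X T m where "skew_params X T m" "G = skew_model X T m"
  using assms skew_params_models unfolding models_def M_defs by blast

lemma generators_agree:
  "irl_agree G1 M1" "irl_agree G2 M2" "irl_agree G3 M3" "irl_agree G4 M4" "irl_agree G5 M5"
  "irl_agree G6 M6"
proof -
  have I: "{x \<in> {bt, ee}. dunn_le x ee} = {bt, ee}"
    "{x \<in> {bt, ee, tp}. dunn_le x tp} = {bt, ee, tp}"
    "{x \<in> {bt, ee, tp}. dunn_le x ee} = {bt, ee, tp} - {tp}"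
    "{x \<in> {bt, ee, aa, tp}. dunn_le x aa} = {bt, ee, aa, tp} - {tp}"
    "{x \<in> {bt, ee, ss, tt, tp}. dunn_le x tt} = {bt, ee, ss, tt, tp} - {tp}"
    "{x \<in> {bt, ee, ss, tt, uu, tp}. dunn_le x uu} = {bt, ee, ss, tt, uu, tp} - {tp}"
    by (auto simp: dunn_le_def)
  have c: "carrier (dunn_on X) = X" for X
    by (simp add: dunn_on_def Let_def)
  show "irl_agree G1 M1" "irl_agree G2 M2" "irl_agree G3 M3" "irl_agree G4 M4"
    "irl_agree G5 M5" "irl_agree G6 M6"
    using skew_params_models[THEN skew_reflection_agree] unfolding I
    by (simp_all only: M_defs G1_def G2_def G3_def G4_def G5_def G6_def reflection_def
        two_plus_def S3_plus_def C4_plus_def T5_def T6_def c)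
qed

lemma in_generated_variety_models:
  "in_generated_variety {G1, G2, G3, G4, G5, G6} A \<longleftrightarrow> in_generated_variety models A"
  using generators_agree[THEN irl_agree_in_variety]
  by (simp add: in_generated_variety_def models_def)

lemma irl_algebra_models: "G \<in> models \<Longrightarrow> irl_algebra G"
  by (metis models_cases irl_algebra_skew_model)

section \<open>Collapsing onto the constants\<close>

fun collapse :: "dunn_elem skew \<Rightarrow> dunn_elem skew" where
  "collapse Zero = Zero"
| "collapse (Base b) = Base ee"
| "collapse (Copy b) = Copy ee"
| "collapse One = One"

lemma dunn_ee_simps [simp]:
  "dunn_imp ee x = x" "dunn_mult x ee = x" "dunn_mult ee x = x" "dunn_mult x bt = bt"
  "dunn_imp bt x = tp" "dunn_inf x x = x" "dunn_sup x x = x" "dunn_le x tp"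
  by (cases x; simp add: dunn_op_defs)+

lemma dunn_inf_ee: "dunn_inf x ee = (if dunn_le ee x then ee else bt)"
  "dunn_inf ee x = (if dunn_le ee x then ee else bt)"
  by (cases x; simp add: dunn_op_defs)+

lemma dunn_inf_absorb: "dunn_le x y \<Longrightarrow> dunn_inf x y = x" "dunn_le x y \<Longrightarrow> dunn_inf y x = x"
  by (auto simp: dunn_inf_def dunn_le_antisym)

lemma collapse_neg: "collapse (skew_neg x) = skew_neg (collapse x)"
  by (cases x) auto

text \<open>Source and target may be different generators. After collapsing, the only meet of an
  element of \<open>B\<close> with a copy is \<open>e \<and> e'\<close>, which is \<open>e\<close>
  as soon as \<open>e \<le> m'\<close>.\<close>

lemma collapse_inf: "dunn_le ee m' \<Longrightarrow>
    collapse (skew_inf m x y) = skew_inf m' (collapse x) (collapse y)"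
  by (cases x; cases y) (auto simp: dunn_inf_absorb)

lemma collapse_sup: "dunn_le ee m' \<Longrightarrow>
    collapse (skew_sup m x y) = skew_sup m' (collapse x) (collapse y)"
  by (simp add: skew_sup_def collapse_neg collapse_inf)

lemma collapse_times: "dunn_le ee T' \<Longrightarrow>
    collapse (skew_times T x y) = skew_times T' (collapse x) (collapse y)"
  by (cases x; cases y) (auto simp: dunn_inf_absorb)

lemma collapse_eval_term:
  assumes "G \<in> models" "H \<in> models"
  shows "eval_term H (collapse \<circ> w) t = collapse (eval_term G w t)"
proof -
  obtain X T m where G: "G = skew_model X T m" using assms models_cases by metis
  obtain X' T' m' where H: "skew_params X' T' m'" "H = skew_model X' T' m'"
    using assms models_cases by metis
  then have "dunn_le ee T'" "dunn_le ee m'" by (auto simp: skew_params_def)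
  then show ?thesis unfolding G H
    by (induction t)
       (auto simp: collapse_neg collapse_inf[of m' m] collapse_sup[of m' m] collapse_times[of T' T])
qed

section \<open>Terms for equivalence and normalisation\<close>

abbreviation "term_imp s t \<equiv> Neg (Mult s (Neg t))"
abbreviation "term_zero \<equiv> Neg (Mult (Neg Unit) (Neg Unit))"
definition "term_dist s t = Meet (Meet (term_imp s t) (term_imp t s)) Unit"
text \<open>Joining the distances to the four constants tests for being a constant, and so turns any
  argument into one of the two values \<open>e\<close> and \<bottom>.\<close>

definition "term_nrm t =
   Join (Join (term_dist t Unit) (term_dist t (Neg Unit)))
     (Join (term_dist t term_zero) (term_dist t (Neg term_zero)))"
text \<open>At \<bottom>, these three terms take the values \<open>T\<close>, \<open>m\<close> and
  \<open>T \<rightarrow> m\<close> in the algebra with parameters \<open>T\<close> and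
  \<open>m\<close>.\<close>

abbreviation "term_top t \<equiv> term_imp t t"
abbreviation "term_mid t \<equiv> Meet (term_top t) (Neg Unit)"
abbreviation "term_fix t \<equiv> Meet (term_top t) (Neg (term_top t))"

definition skew_dist :: "dunn_elem skew \<Rightarrow> dunn_elem skew \<Rightarrow> dunn_elem skew" where
  "skew_dist x y = (if x = y then Base ee else if collapse x = collapse y then Base bt else Zero)"

lemma ee_le_imp: "dunn_le ee (dunn_imp b c) \<longleftrightarrow> dunn_le b c"
  by (simp add: dunn_le_imp_iff)

text \<open>For two elements of \<open>B\<close>, or two copies, the implications lie in
  \<open>B\<close> and are both above \<open>e\<close> only in case of equality; their meet with
  \<open>e\<close> is \<open>e\<close> or \<bottom>. If the collapses differ, one implication is
  \<open>0\<close>.\<close>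

lemma eval_term_dist:
  assumes "G \<in> models"
  shows "eval_term G w (term_dist s t) = skew_dist (eval_term G w s) (eval_term G w t)"
proof -
  obtain X T m where G: "skew_params X T m" "G = skew_model X T m"
    using assms models_cases by metis
  then have "dunn_le ee T" by (simp add: skew_params_def)
  then show ?thesis unfolding G
    by (cases "eval_term (skew_model X T m) w s"; cases "eval_term (skew_model X T m) w t")
       (auto simp: term_dist_def skew_dist_def dunn_inf_ee dunn_le_inf_iff ee_le_imp
         intro: dunn_le_antisym)
qed

lemma skew_sup_negative:
  assumes "x \<in> {Base ee, Base bt, Zero}" "y \<in> {Base ee, Base bt, Zero}"
  shows "skew_sup m x y = (if Base ee \<in> {x, y} then Base ee else if Base bt \<in> {x, y} then Base bt else Zero)"
  using assms by (auto simp: skew_sup_def dunn_op_defs)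

lemma skew_dist_negative: "skew_dist x y \<in> {Base ee, Base bt, Zero}"
  by (simp add: skew_dist_def)

text \<open>Every element collapses to one of the constants, so some distance is at least \<bottom>;
  some distance is \<open>e\<close> exactly for the constants themselves.\<close>

lemma eval_term_nrm:
  assumes "G \<in> models"
  shows "eval_term G w (term_nrm t) =
     (if eval_term G w t \<in> range collapse then Base ee else Base bt)"
proof -
  obtain X T m where G: "skew_params X T m" "G = skew_model X T m"
    using assms models_cases by metis
  have [simp]: "sup_op G = skew_sup m" "one G = Base ee" "mult G = skew_times T" "neg_op G = skew_neg"
    by (simp_all add: G)
  have r: "range collapse = {Zero, One, Base ee, Copy ee}"
  proof
    show "range collapse \<subseteq> {Zero, One, Base ee, Copy ee}" 
    proof
      fix y assume "y \<in> range collapse"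
      then obtain x where "y = collapse x" by blast
      then show "y \<in> {Zero, One, Base ee, Copy ee}" by (cases x) auto
    qed
    show "{Zero, One, Base ee, Copy ee} \<subseteq> range collapse"
      by (auto intro: range_eqI[of _ _ "Zero"] range_eqI[of _ _ "One"] range_eqI[of _ _ "Base ee"]
          range_eqI[of _ _ "Copy ee"])
  qed
  show ?thesis
    unfolding r
    by (cases "eval_term G w t")
       (auto simp: term_nrm_def eval_term_dist[OF assms] skew_sup_negative skew_dist_def)
qed

section \<open>Identities of the variety\<close>

lemma identity_transfer:
  assumes "in_generated_variety models E"
    and "\<And>G w. G \<in> models \<Longrightarrow> range w \<subseteq> carrier G \<Longrightarrow> eval_term G w s = eval_term G w t"
    and "range v \<subseteq> carrier E"
  shows "eval_term E v s = eval_term E v t"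
proof -
  have "\<forall>G\<in>models. in_variety {(s, t)} G"
    using assms(2) irl_algebra_models by (auto simp: in_variety_def)
  then have "in_variety {(s, t)} E"
    using assms(1) unfolding in_generated_variety_def by blast
  then show ?thesis using assms(3) by (auto simp: in_variety_def)
qed

lemma irl_algebra_generated: "in_generated_variety models E \<Longrightarrow> irl_algebra E"
  using irl_algebra_models unfolding in_generated_variety_def in_variety_def by blast

lemma irl_algebra_closed:
  assumes "irl_algebra A"
  shows "\<one>\<^bsub>A\<^esub> \<in> carrier A" "x \<in> carrier A \<Longrightarrow> neg_op A x \<in> carrier A"
    "x \<in> carrier A \<Longrightarrow> y \<in> carrier A \<Longrightarrow> x \<otimes>\<^bsub>A\<^esub> y \<in> carrier A"
    "x \<in> carrier A \<Longrightarrow> y \<in> carrier A \<Longrightarrow> inf_op A x y \<in> carrier A"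
    "x \<in> carrier A \<Longrightarrow> y \<in> carrier A \<Longrightarrow> sup_op A x y \<in> carrier A"
  using assms by (auto simp: irl_algebra_def)

text \<open>An assignment for terms in three variables. Repeating the last value on all further
  variables keeps its range inside the carrier.\<close>

fun val3 :: "'a \<Rightarrow> 'a \<Rightarrow> 'a \<Rightarrow> nat \<Rightarrow> 'a" where
  "val3 x y z 0 = x"
| "val3 x y z (Suc 0) = y"
| "val3 x y z (Suc (Suc n)) = z"

lemma range_val3: "x \<in> S \<Longrightarrow> y \<in> S \<Longrightarrow> z \<in> S \<Longrightarrow> range (val3 x y z) \<subseteq> S"
proof
  fix u assume "x \<in> S" "y \<in> S" "z \<in> S" "u \<in> range (val3 x y z)"
  then obtain n where "u = val3 x y z n" by blast
  then show "u \<in> S" using \<open>x \<in> S\<close> \<open>y \<in> S\<close> \<open>z \<in> S\<close>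
    by (cases "(x, y, z, n)" rule: val3.cases) auto
qed

abbreviation "X0 \<equiv> Var 0"
abbreviation "X1 \<equiv> Var (Suc 0)"
abbreviation "X2 \<equiv> Var (Suc (Suc 0))"

lemma skew_inf_Base_ee: "skew_inf m x (Base ee) \<in> {Base ee, Base bt, Zero}"
  by (cases x) (auto simp: dunn_inf_ee)

lemma skew_times_ee:
  assumes "skew_params X T m" "x \<in> skew_carrier X"
  shows "skew_times T (Base ee) x = x" "skew_times T x (Base ee) = x"
  using assms by (cases x; auto simp: skew_params_def dunn_inf_absorb)+

text \<open>Multiplication by \<bottom> sends \<open>B\<close> to \<bottom> and \<open>B'\<close> to
  \<open>T'\<close> and fixes \<open>0\<close> and \<open>1\<close>, so it identifies exactly what
  collapsing identifies.\<close>

lemma skew_times_bt_collapse: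
  "skew_times T (Base bt) (collapse x) = skew_times T (Base bt) x"
  "collapse (skew_times T (Base bt) x) = collapse x"
  by (cases x; simp)+

text \<open>The point is that \<open>c \<cdot> f(x, y)\<close> depends only on
  \<open>c \<cdot> x\<close> and \<open>c \<cdot> y\<close>, so that equality after multiplication
  by \<open>c\<close> is a congruence. For \<open>c = \<bottom>\<close> the two factors of
  \<open>c\<close> have the same collapse, hence the same product with \<bottom>.\<close>

lemma models_negative_absorb:
  assumes G: "G \<in> models" and x: "x \<in> carrier G" "y \<in> carrier G"
    and c: "c \<in> {Base ee, Base bt, Zero}"
  shows "c \<otimes>\<^bsub>G\<^esub> (x \<otimes>\<^bsub>G\<^esub> y) = c \<otimes>\<^bsub>G\<^esub> ((c \<otimes>\<^bsub>G\<^esub> x) \<otimes>\<^bsub>G\<^esub> (c \<otimes>\<^bsub>G\<^esub> y))"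
    "c \<otimes>\<^bsub>G\<^esub> (inf_op G x y) = c \<otimes>\<^bsub>G\<^esub> (inf_op G (c \<otimes>\<^bsub>G\<^esub> x) (c \<otimes>\<^bsub>G\<^esub> y))"
    "c \<otimes>\<^bsub>G\<^esub> (sup_op G x y) = c \<otimes>\<^bsub>G\<^esub> (sup_op G (c \<otimes>\<^bsub>G\<^esub> x) (c \<otimes>\<^bsub>G\<^esub> y))"
    "c \<otimes>\<^bsub>G\<^esub> (neg_op G x) = c \<otimes>\<^bsub>G\<^esub> (neg_op G (c \<otimes>\<^bsub>G\<^esub> x))"
proof -
  obtain X T m where P: "skew_params X T m" and G: "G = skew_model X T m"
    using assms models_cases by metis
  then have T: "dunn_le ee T" "dunn_le ee m" by (auto simp: skew_params_def)
  have ee: "skew_times T (Base ee) (collapse u) = collapse u" for u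
    using T(1) by (cases u) (auto simp: dunn_inf_absorb)
  have *: "skew_times T (Base bt) u = skew_times T (Base bt) v" if "collapse u = collapse v" for u v
    using that skew_times_bt_collapse(1) by metis
  show "c \<otimes>\<^bsub>G\<^esub> (x \<otimes>\<^bsub>G\<^esub> y) = c \<otimes>\<^bsub>G\<^esub> ((c \<otimes>\<^bsub>G\<^esub> x) \<otimes>\<^bsub>G\<^esub> (c \<otimes>\<^bsub>G\<^esub> y))"
    "c \<otimes>\<^bsub>G\<^esub> (inf_op G x y) = c \<otimes>\<^bsub>G\<^esub> (inf_op G (c \<otimes>\<^bsub>G\<^esub> x) (c \<otimes>\<^bsub>G\<^esub> y))"
    "c \<otimes>\<^bsub>G\<^esub> (sup_op G x y) = c \<otimes>\<^bsub>G\<^esub> (sup_op G (c \<otimes>\<^bsub>G\<^esub> x) (c \<otimes>\<^bsub>G\<^esub> y))"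
    "c \<otimes>\<^bsub>G\<^esub> (neg_op G x) = c \<otimes>\<^bsub>G\<^esub> (neg_op G (c \<otimes>\<^bsub>G\<^esub> x))"
    using x c skew_model_closed[OF P]
    by (auto simp: G skew_times_ee[OF P] skew_times_bt_collapse collapse_times[OF T(1)]
        collapse_inf[OF T(2)] collapse_sup[OF T(2)] collapse_neg ee intro!: *)
qed

text \<open>The three values form a chain and \<open>0 \<le> \<bottom> \<cdot> x \<le> x\<close>, so
  both sides are the product of \<open>x\<close> with the larger of \<open>c\<close> and
  \<open>d\<close>.\<close>

lemma models_negative_join:
  assumes G: "G \<in> models" and x: "x \<in> carrier G"
    and c: "c \<in> {Base ee, Base bt, Zero}" "d \<in> {Base ee, Base bt, Zero}"
  shows "sup_op G c d \<otimes>\<^bsub>G\<^esub> x = sup_op G (c \<otimes>\<^bsub>G\<^esub> x) (d \<otimes>\<^bsub>G\<^esub> x)"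
proof -
  obtain X T m where P: "skew_params X T m" and G: "G = skew_model X T m"
    using assms models_cases by metis
  have T: "\<And>b. b \<in> X \<Longrightarrow> dunn_le b T" using P by (auto simp: skew_params_def)
  have inf: "dunn_inf b bt = bt" "dunn_inf bt b = bt" "dunn_sup b bt = b" "dunn_sup bt b = b"
    "dunn_inf tp b = b" "dunn_inf b tp = b" "dunn_inf T T = T" for b
    by (cases b; simp add: dunn_op_defs)+
  have xc: "x \<in> skew_carrier X" using x G by simp
  let ?y = "skew_times T (Base bt) x"
  have "skew_sup m x x = x" "skew_sup m ?y ?y = ?y" "skew_sup m x ?y = x" "skew_sup m ?y x = x"
    using xc by (cases x; simp add: skew_sup_def inf T dunn_inf_absorb)+
  moreover have "skew_sup m u Zero = u" "skew_sup m Zero u = u" for u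
    by (cases u; simp add: skew_sup_def)+
  ultimately show ?thesis
    unfolding G using c skew_times_ee(1)[OF P xc]
    by (elim insertE emptyE) (simp_all add: skew_sup_negative)
qed

abbreviation "term_neg t \<equiv> Meet t Unit"

lemma eval_term_neg_cases:
  "G \<in> models \<Longrightarrow> eval_term G w (term_neg t) \<in> {Base ee, Base bt, Zero}"
  by (erule models_cases) (simp only: eval_term.simps skew_model_simps skew_inf_Base_ee)

lemma eval_term_dist_cases:
  "G \<in> models \<Longrightarrow> eval_term G w (term_dist s t) \<in> {Base ee, Base bt, Zero}"
  using skew_dist_negative by (simp add: eval_term_dist)

lemma models_eval_in_carrier:
  "G \<in> models \<Longrightarrow> range w \<subseteq> carrier G \<Longrightarrow> eval_term G w t \<in> carrier G"
  using irl_algebra_models eval_term_in_carrier by blast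

lemma models_eval_unit: "G \<in> models \<Longrightarrow> \<one>\<^bsub>G\<^esub> = Base ee"
  by (auto elim!: models_cases)

lemma models_unit:
  assumes "G \<in> models" "x \<in> carrier G"
  shows "Base ee \<otimes>\<^bsub>G\<^esub> x = x" "x \<otimes>\<^bsub>G\<^esub> Base ee = x"
  using assms by (auto elim!: models_cases simp: skew_times_ee)

section \<open>Negative elements and their congruences in a member of the variety\<close>

context
  fixes E :: "'a irl"
  assumes E: "in_generated_variety models E"
begin

text \<open>The condition \<open>a \<le> e\<close> is not an identity, but facts about all elements
  \<open>a \<and> e\<close> are, and in the models these take only the values \<open>e\<close>,
  \<bottom> and \<open>0\<close>.\<close>

abbreviation "neg_part a \<equiv> inf_op E a \<one>\<^bsub>E\<^esub>"

lemma generated_negative_absorb: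
  assumes "a \<in> carrier E" "x \<in> carrier E" "y \<in> carrier E"
  shows "neg_part a \<otimes>\<^bsub>E\<^esub> (x \<otimes>\<^bsub>E\<^esub> y) = neg_part a \<otimes>\<^bsub>E\<^esub> ((neg_part a \<otimes>\<^bsub>E\<^esub> x) \<otimes>\<^bsub>E\<^esub> (neg_part a \<otimes>\<^bsub>E\<^esub> y))"
    "neg_part a \<otimes>\<^bsub>E\<^esub> (inf_op E x y) = neg_part a \<otimes>\<^bsub>E\<^esub> (inf_op E (neg_part a \<otimes>\<^bsub>E\<^esub> x) (neg_part a \<otimes>\<^bsub>E\<^esub> y))"
    "neg_part a \<otimes>\<^bsub>E\<^esub> (sup_op E x y) = neg_part a \<otimes>\<^bsub>E\<^esub> (sup_op E (neg_part a \<otimes>\<^bsub>E\<^esub> x) (neg_part a \<otimes>\<^bsub>E\<^esub> y))"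
    "neg_part a \<otimes>\<^bsub>E\<^esub> (neg_op E x) = neg_part a \<otimes>\<^bsub>E\<^esub> (neg_op E (neg_part a \<otimes>\<^bsub>E\<^esub> x))"
proof -
  note v = range_val3[OF assms]
  let ?n = "term_neg X0"
  have m: "eval_term G w (Mult ?n (Mult X1 X2)) = eval_term G w (Mult ?n (Mult (Mult ?n X1) (Mult ?n X2)))"
    "eval_term G w (Mult ?n (Meet X1 X2)) = eval_term G w (Mult ?n (Meet (Mult ?n X1) (Mult ?n X2)))"
    "eval_term G w (Mult ?n (Join X1 X2)) = eval_term G w (Mult ?n (Join (Mult ?n X1) (Mult ?n X2)))"
    "eval_term G w (Mult ?n (Neg X1)) = eval_term G w (Mult ?n (Neg (Mult ?n X1)))"
    if "G \<in> models" "range w \<subseteq> carrier G" for G w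
    using models_negative_absorb[OF that(1) models_eval_in_carrier[OF that]
        models_eval_in_carrier[OF that] eval_term_neg_cases[OF that(1)]]
    unfolding eval_term.simps(3,4,6) eval_term.simps(5)[of _ _ X1 X2]
      eval_term.simps(5)[of _ _ "Mult ?n X1"] by blast+
  from m[THEN identity_transfer[OF E _ v]]
  show "neg_part a \<otimes>\<^bsub>E\<^esub> (x \<otimes>\<^bsub>E\<^esub> y) = neg_part a \<otimes>\<^bsub>E\<^esub> ((neg_part a \<otimes>\<^bsub>E\<^esub> x) \<otimes>\<^bsub>E\<^esub> (neg_part a \<otimes>\<^bsub>E\<^esub> y))"
    "neg_part a \<otimes>\<^bsub>E\<^esub> (inf_op E x y) = neg_part a \<otimes>\<^bsub>E\<^esub> (inf_op E (neg_part a \<otimes>\<^bsub>E\<^esub> x) (neg_part a \<otimes>\<^bsub>E\<^esub> y))"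
    "neg_part a \<otimes>\<^bsub>E\<^esub> (sup_op E x y) = neg_part a \<otimes>\<^bsub>E\<^esub> (sup_op E (neg_part a \<otimes>\<^bsub>E\<^esub> x) (neg_part a \<otimes>\<^bsub>E\<^esub> y))"
    "neg_part a \<otimes>\<^bsub>E\<^esub> (neg_op E x) = neg_part a \<otimes>\<^bsub>E\<^esub> (neg_op E (neg_part a \<otimes>\<^bsub>E\<^esub> x))"
    by simp_all
qed

lemma generated_closed:
  "\<one>\<^bsub>E\<^esub> \<in> carrier E" "x \<in> carrier E \<Longrightarrow> neg_op E x \<in> carrier E"
  "x \<in> carrier E \<Longrightarrow> y \<in> carrier E \<Longrightarrow> x \<otimes>\<^bsub>E\<^esub> y \<in> carrier E"
  "x \<in> carrier E \<Longrightarrow> y \<in> carrier E \<Longrightarrow> inf_op E x y \<in> carrier E"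
  "x \<in> carrier E \<Longrightarrow> y \<in> carrier E \<Longrightarrow> sup_op E x y \<in> carrier E"
  by (fact irl_algebra_closed[OF irl_algebra_generated[OF E]])+

lemma generated_unit:
  assumes "x \<in> carrier E"
  shows "\<one>\<^bsub>E\<^esub> \<otimes>\<^bsub>E\<^esub> x = x" "x \<otimes>\<^bsub>E\<^esub> \<one>\<^bsub>E\<^esub> = x"
proof -
  note v = range_val3[OF assms assms assms]
  have "eval_term G w (Mult Unit X0) = eval_term G w X0"
    "eval_term G w (Mult X0 Unit) = eval_term G w X0"
    if "G \<in> models" "range w \<subseteq> carrier G" for G w
    using that models_unit[OF that(1), of "w 0"] by (auto simp: models_eval_unit)
  from this[THEN identity_transfer[OF E _ v]]
  show "\<one>\<^bsub>E\<^esub> \<otimes>\<^bsub>E\<^esub> x = x" "x \<otimes>\<^bsub>E\<^esub> \<one>\<^bsub>E\<^esub> = x" by simp_all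
qed

lemma generated_negative:
  assumes "a \<in> carrier E" "b \<in> carrier E" "x \<in> carrier E"
  shows "sup_op E (neg_part a) (neg_part b) \<otimes>\<^bsub>E\<^esub> x = sup_op E (neg_part a \<otimes>\<^bsub>E\<^esub> x) (neg_part b \<otimes>\<^bsub>E\<^esub> x)"
    "neg_part a \<otimes>\<^bsub>E\<^esub> neg_part a = neg_part a"
    "neg_part \<one>\<^bsub>E\<^esub> = \<one>\<^bsub>E\<^esub>"
proof -
  note v = range_val3[OF assms]
  let ?a = "term_neg X0" and ?b = "term_neg X1"
  have "eval_term G w (Mult (Join ?a ?b) X2) = eval_term G w (Join (Mult ?a X2) (Mult ?b X2))"
    if "G \<in> models" "range w \<subseteq> carrier G" for G w
    unfolding eval_term.simps(4,6)
    by (intro models_negative_join eval_term_neg_cases models_eval_in_carrier that)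
  from identity_transfer[OF E this v]
  show "sup_op E (neg_part a) (neg_part b) \<otimes>\<^bsub>E\<^esub> x = sup_op E (neg_part a \<otimes>\<^bsub>E\<^esub> x) (neg_part b \<otimes>\<^bsub>E\<^esub> x)"
    by simp
  have idem: "y \<otimes>\<^bsub>G\<^esub> y = y" if "G \<in> models" "y \<in> {Base ee, Base bt, Zero}" for G y
    using that by (auto elim!: models_cases)
  have "eval_term G w (Mult ?a ?a) = eval_term G w ?a" if "G \<in> models" for G w
    unfolding eval_term.simps(4) by (intro idem eval_term_neg_cases that)
  from identity_transfer[OF E this v] show "neg_part a \<otimes>\<^bsub>E\<^esub> neg_part a = neg_part a" by simp
  have "eval_term G w (Meet Unit Unit) = eval_term G w Unit" if "G \<in> models" for G w
    using that by (auto elim!: models_cases)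
  from identity_transfer[OF E this v] show "neg_part \<one>\<^bsub>E\<^esub> = \<one>\<^bsub>E\<^esub>" by simp
qed

text \<open>The distance \<open>d\<close> of \<open>s\<close> and \<open>t\<close> satisfies
  \<open>d \<cdot> s = d \<cdot> t\<close> in the models, which gives \<open>s = t\<close> when
  \<open>d = e\<close>. The converse is the identity that a term has distance \<open>e\<close> from
  itself.\<close>

lemma generated_dist:
  assumes v: "range v \<subseteq> carrier E"
  shows "eval_term E v (term_dist s t) = \<one>\<^bsub>E\<^esub> \<longleftrightarrow> eval_term E v s = eval_term E v t"
    and "neg_part (eval_term E v (term_dist s t)) = eval_term E v (term_dist s t)"
proof -
  have in_E: "eval_term E v r \<in> carrier E" for r
    using eval_term_in_carrier[OF irl_algebra_generated[OF E] v] .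
  let ?d = "term_dist s t"
  have "eval_term G w (Mult ?d s) = eval_term G w (Mult ?d t)"
    if G: "G \<in> models" and w: "range w \<subseteq> carrier G" for G w
  proof -
    obtain X T m where XT: "G = skew_model X T m" using G models_cases by metis
    show ?thesis
      using skew_times_bt_collapse(1)[of T "eval_term G w s"]
        skew_times_bt_collapse(1)[of T "eval_term G w t"]
      unfolding eval_term.simps eval_term_dist[OF G] by (auto simp: skew_dist_def XT)
  qed
  from identity_transfer[OF E this v]
  have 1: "eval_term E v ?d \<otimes>\<^bsub>E\<^esub> eval_term E v s = eval_term E v ?d \<otimes>\<^bsub>E\<^esub> eval_term E v t"
    by simp
  have "eval_term E v (term_dist s s) = eval_term E v Unit" for s
    by (rule identity_transfer[OF E _ v]) (simp add: eval_term_dist skew_dist_def models_eval_unit)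
  then have "eval_term E v ?d = \<one>\<^bsub>E\<^esub>" if "eval_term E v s = eval_term E v t"
    using that by (simp add: term_dist_def)
  then show "eval_term E v ?d = \<one>\<^bsub>E\<^esub> \<longleftrightarrow> eval_term E v s = eval_term E v t"
    using 1 in_E by (auto simp: generated_unit)
  have "eval_term G w (term_neg ?d) = eval_term G w ?d" if "G \<in> models" for G and w :: "nat \<Rightarrow> dunn_elem skew"
    using eval_term_dist_cases[OF that, of w s t] that
    by (auto elim!: models_cases simp: dunn_inf_ee dunn_le_def)
  then have "eval_term E v (term_neg ?d) = eval_term E v ?d"
    by (intro identity_transfer[OF E _ v]) auto
  then show "neg_part (eval_term E v (term_dist s t)) = eval_term E v (term_dist s t)"
    by simp
qed

lemma negative_congruence:
  assumes a: "a \<in> carrier E"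
  shows "irl_congruence E {(x, y). x \<in> carrier E \<and> y \<in> carrier E \<and> neg_part a \<otimes>\<^bsub>E\<^esub> x = neg_part a \<otimes>\<^bsub>E\<^esub> y}"
proof -
  note abs = generated_negative_absorb[OF a]
  have n: "neg_part a \<otimes>\<^bsub>E\<^esub> neg_op E x = neg_part a \<otimes>\<^bsub>E\<^esub> neg_op E y"
    if "x \<in> carrier E" "y \<in> carrier E" "neg_part a \<otimes>\<^bsub>E\<^esub> x = neg_part a \<otimes>\<^bsub>E\<^esub> y" for x y
    using abs(4)[OF that(1,1)] abs(4)[OF that(2,2)] by (simp only: that(3))
  have b: "neg_part a \<otimes>\<^bsub>E\<^esub> (x \<otimes>\<^bsub>E\<^esub> u) = neg_part a \<otimes>\<^bsub>E\<^esub> (y \<otimes>\<^bsub>E\<^esub> v)"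
    "neg_part a \<otimes>\<^bsub>E\<^esub> inf_op E x u = neg_part a \<otimes>\<^bsub>E\<^esub> inf_op E y v"
    "neg_part a \<otimes>\<^bsub>E\<^esub> sup_op E x u = neg_part a \<otimes>\<^bsub>E\<^esub> sup_op E y v"
    if "x \<in> carrier E" "y \<in> carrier E" "u \<in> carrier E" "v \<in> carrier E"
      "neg_part a \<otimes>\<^bsub>E\<^esub> x = neg_part a \<otimes>\<^bsub>E\<^esub> y" "neg_part a \<otimes>\<^bsub>E\<^esub> u = neg_part a \<otimes>\<^bsub>E\<^esub> v" for x y u v
    using abs(1)[OF that(1,3)] abs(1)[OF that(2,4)] abs(2)[OF that(1,3)] abs(2)[OF that(2,4)]
      abs(3)[OF that(1,3)] abs(3)[OF that(2,4)]
    by (simp_all only: that(5,6))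
  show ?thesis
    unfolding irl_congruence_def
    by (auto simp: equiv_def refl_on_def sym_def trans_def generated_closed intro: n b)
qed

text \<open>For negative \<open>a\<close> and \<open>b\<close> with join \<open>e\<close>,
  \<open>x = (a \<or> b) \<cdot> x = a \<cdot> x \<or> b \<cdot> x\<close>. So the congruences of
  \<open>a\<close> and \<open>b\<close> meet in the identity, and one of them is the
  identity.\<close>

lemma unit_join_prime:
  assumes "subdirectly_irreducible E" "a \<in> carrier E" "b \<in> carrier E"
    and e: "sup_op E (neg_part a) (neg_part b) = \<one>\<^bsub>E\<^esub>"
  shows "neg_part a = \<one>\<^bsub>E\<^esub> \<or> neg_part b = \<one>\<^bsub>E\<^esub>"
proof -
  let ?\<theta> = "\<lambda>a. {(x, y). x \<in> carrier E \<and> y \<in> carrier E \<and> neg_part a \<otimes>\<^bsub>E\<^esub> x = neg_part a \<otimes>\<^bsub>E\<^esub> y}"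
  have "x = y" if "x \<in> carrier E" "y \<in> carrier E" "neg_part a \<otimes>\<^bsub>E\<^esub> x = neg_part a \<otimes>\<^bsub>E\<^esub> y"
    "neg_part b \<otimes>\<^bsub>E\<^esub> x = neg_part b \<otimes>\<^bsub>E\<^esub> y" for x y
    using that generated_negative(1)[OF assms(2,3), of x] generated_negative(1)[OF assms(2,3), of y]
    by (simp add: e generated_unit)
  then have "carrier E \<times> carrier E \<inter> \<Inter> {?\<theta> a, ?\<theta> b} = Id_on (carrier E)"
    by (auto simp: Id_on_def)
  moreover have "\<forall>\<theta>\<in>{?\<theta> a, ?\<theta> b}. irl_congruence E \<theta>"
    using negative_congruence assms(2,3) by simp
  ultimately have "Id_on (carrier E) \<in> {?\<theta> a, ?\<theta> b}"
    using assms(1) unfolding subdirectly_irreducible_def by blast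
  moreover have "neg_part c = \<one>\<^bsub>E\<^esub>" if "Id_on (carrier E) = ?\<theta> c" "c \<in> carrier E" for c
  proof -
    \<comment> \<open>Idempotence gives \<open>c \<cdot> c = c = c \<cdot> e\<close> for negative
      \<open>c\<close>.\<close>
    have "(neg_part c, \<one>\<^bsub>E\<^esub>) \<in> ?\<theta> c"
      using that(2) by (simp add: generated_closed generated_negative generated_unit)
    then show ?thesis unfolding that(1)[symmetric] by (simp add: Id_on_def)
  qed
  ultimately show ?thesis using assms(2,3) by blast
qed

end

section \<open>Projectivity of algebras generated by one element\<close>

primrec subst_term :: "(nat \<Rightarrow> irl_term) \<Rightarrow> irl_term \<Rightarrow> irl_term" where
  "subst_term \<sigma> (Var n) = \<sigma> n"
| "subst_term \<sigma> Unit = Unit"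
| "subst_term \<sigma> (Neg t) = Neg (subst_term \<sigma> t)"
| "subst_term \<sigma> (Mult s t) = Mult (subst_term \<sigma> s) (subst_term \<sigma> t)"
| "subst_term \<sigma> (Meet s t) = Meet (subst_term \<sigma> s) (subst_term \<sigma> t)"
| "subst_term \<sigma> (Join s t) = Join (subst_term \<sigma> s) (subst_term \<sigma> t)"

lemma eval_subst_term: "eval_term A v (subst_term \<sigma> t) = eval_term A (\<lambda>n. eval_term A v (\<sigma> n)) t"
  by (induction t) auto

lemma irl_hom_eval_term:
  assumes h: "h \<in> irl_hom A B" and A: "irl_algebra A" and v: "range v \<subseteq> carrier A"
  shows "h (eval_term A v t) = eval_term B (h \<circ> v) t"
proof (induction t)
  case (Neg t)
  then show ?case using h eval_term_in_carrier[OF A v, of t] by (simp add: irl_hom_def)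
next
  case (Mult s t)
  then show ?case using h eval_term_in_carrier[OF A v, of s] eval_term_in_carrier[OF A v, of t]
    by (simp add: irl_hom_def hom_def)
next
  case (Meet s t)
  then show ?case using h eval_term_in_carrier[OF A v, of s] eval_term_in_carrier[OF A v, of t]
    by (simp add: irl_hom_def)
next
  case (Join s t)
  then show ?case using h eval_term_in_carrier[OF A v, of s] eval_term_in_carrier[OF A v, of t]
    by (simp add: irl_hom_def)
qed (use h in \<open>simp_all add: irl_hom_def\<close>)

text \<open>By \<open>eq\<close>, every equation true of the generator \<open>b\<close> becomes an
  identity of the variety once \<open>p\<close> is substituted for its variables. Hence
  \<open>b \<mapsto> p(a)\<close> extends to a homomorphism for any \<open>a\<close>, and it is a
  section if \<open>a\<close> is a preimage of \<open>b\<close>.\<close>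

lemma projective_if_generated:
  fixes E :: "'a irl"
  assumes E: "in_generated_variety models E" and b: "b \<in> carrier E"
    and gen: "\<And>x. x \<in> carrier E \<Longrightarrow> \<exists>q. x = eval_term E (\<lambda>_. b) q"
    and p: "eval_term E (\<lambda>_. b) p = b"
    and eq: "\<And>q r G w. eval_term E (\<lambda>_. b) q = eval_term E (\<lambda>_. b) r \<Longrightarrow> G \<in> models \<Longrightarrow>
      range w \<subseteq> carrier G \<Longrightarrow>
      eval_term G (\<lambda>_. eval_term G w p) q = eval_term G (\<lambda>_. eval_term G w p) r"
  shows "projective_in_generated_variety TYPE('b) models E"
  unfolding projective_in_generated_variety_def
proof (intro conjI allI impI)
  fix A :: "'b irl" and h
  assume "in_generated_variety models A \<and> h \<in> irl_hom A E \<and> h ` carrier A = carrier E"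
  then have A: "in_generated_variety models A" and h: "h \<in> irl_hom A E"
    and surj: "h ` carrier A = carrier E" by simp_all
  note algA = irl_algebra_generated[OF A] and algE = irl_algebra_generated[OF E]
  have "b \<in> h ` carrier A" using b by (simp only: surj)
  then obtain a where a: "a \<in> carrier A" "h a = b" by (elim imageE) simp
  \<comment> \<open>The preimage \<open>a\<close> may violate equations that hold of
    \<open>b\<close>; \<open>p(a)\<close> does not, and \<open>p(b) = b\<close> makes it a preimage
    as well.\<close>
  define c where "c = eval_term A (\<lambda>_. a) p"
  have c: "c \<in> carrier A" "h c = b"
    using a(1) eval_term_in_carrier[OF algA, of "\<lambda>_. a" p]
      irl_hom_eval_term[OF h algA, of "\<lambda>_. a" p] by (auto simp: c_def comp_def a(2) p)
  have eqA: "eval_term A (\<lambda>_. c) q = eval_term A (\<lambda>_. c) r"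
    if "eval_term E (\<lambda>_. b) q = eval_term E (\<lambda>_. b) r" for q r
  proof -
    have "eval_term A (\<lambda>_. a) (subst_term (\<lambda>_. p) q) = eval_term A (\<lambda>_. a) (subst_term (\<lambda>_. p) r)"
    proof (rule identity_transfer[OF A])
      fix G and w :: "nat \<Rightarrow> dunn_elem skew"
      assume "G \<in> models" "range w \<subseteq> carrier G"
      from eq[OF that this]
      show "eval_term G w (subst_term (\<lambda>_. p) q) = eval_term G w (subst_term (\<lambda>_. p) r)"
        by (simp add: eval_subst_term)
    qed (use a in auto)
    then show ?thesis by (simp add: eval_subst_term c_def)
  qed
  \<comment> \<open>\<open>T x\<close> is some term naming \<open>x\<close> from \<open>b\<close>;
    by \<open>eqA\<close>, the choice does not affect \<open>g\<close>.\<close>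
  define T where "T x = (SOME q. x = eval_term E (\<lambda>_. b) q)" for x
  have T: "eval_term E (\<lambda>_. b) (T x) = x" if "x \<in> carrier E" for x
    unfolding T_def by (rule someI_ex[OF gen[OF that], symmetric])
  define g where "g x = eval_term A (\<lambda>_. c) (T x)" for x
  have g: "g x = eval_term A (\<lambda>_. c) q" if "x = eval_term E (\<lambda>_. b) q" for x q
  proof -
    have "x \<in> carrier E" unfolding that by (rule eval_term_in_carrier[OF algE]) (use b in auto)
    then show ?thesis unfolding g_def by (intro eqA) (simp only: T that[symmetric])
  qed
  have "g \<in> irl_hom E A"
  proof -
    have "g x \<in> carrier A" for x
      unfolding g_def by (rule eval_term_in_carrier[OF algA]) (use c(1) in auto)
    moreover have "g (x \<otimes>\<^bsub>E\<^esub> y) = g x \<otimes>\<^bsub>A\<^esub> g y" "g (inf_op E x y) = inf_op A (g x) (g y)"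
      "g (sup_op E x y) = sup_op A (g x) (g y)" "g (neg_op E x) = neg_op A (g x)"
      if "x \<in> carrier E" "y \<in> carrier E" for x y
      using T[OF that(1)] T[OF that(2)] g[of "x \<otimes>\<^bsub>E\<^esub> y" "Mult (T x) (T y)"]
        g[of "inf_op E x y" "Meet (T x) (T y)"] g[of "sup_op E x y" "Join (T x) (T y)"]
        g[of "neg_op E x" "Neg (T x)"]
      by (simp_all add: g_def[of x] g_def[of y])
    moreover have "g \<one>\<^bsub>E\<^esub> = \<one>\<^bsub>A\<^esub>" using g[of "\<one>\<^bsub>E\<^esub>" Unit] by simp
    ultimately show ?thesis by (simp add: irl_hom_def hom_def)
  qed
  moreover have "\<forall>x\<in>carrier E. h (g x) = x"
    using irl_hom_eval_term[OF h algA, of "\<lambda>_. c"] c by (auto simp: g_def comp_def T)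
  ultimately show "\<exists>g\<in>irl_hom E A. \<forall>x\<in>carrier E. h (g x) = x" by blast
qed (fact E)

text \<open>Besides \<bottom>, \<open>e\<close>, \<open>T\<close> and \<open>m\<close>, only
  \<open>s\<close> and the \<open>t\<close> of \<open>M6\<close> have to be reached:
  \<open>s = T \<rightarrow> m\<close> and \<open>t = e \<or> s\<close>. Copies are negations, and
  \<open>0\<close> and \<open>1\<close> are constants.\<close>

lemma models_Base_generated:
  "list_all (\<lambda>G. \<forall>b\<in>{bt, ee, aa, ss, tt, uu, tp}. Base b \<in> carrier G \<longrightarrow>
     Base b \<in> eval_term G (\<lambda>_. Base bt) `
       {X0, Unit, term_top X0, term_mid X0, term_fix X0, Join Unit (term_fix X0)})
     [M1, M2, M3, M4, M5, M6]"
  by code_simp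

lemma models_generated:
  assumes "G \<in> models" "x \<in> carrier G"
  shows "\<exists>q. x = eval_term G (\<lambda>_. Base bt) q"
proof -
  have base: "\<exists>q. Base b = eval_term G (\<lambda>_. Base bt) q" if "Base b \<in> carrier G" for b
  proof -
    have "b \<in> {bt, ee, aa, ss, tt, uu, tp}" by (cases b) auto
    moreover have "G \<in> set [M1, M2, M3, M4, M5, M6]" using assms(1) by (simp add: models_def)
    ultimately show ?thesis
      using models_Base_generated[unfolded list_all_iff, rule_format] that by blast
  qed
  obtain X T m where G: "G = skew_model X T m" using assms models_cases by metis
  show ?thesis
  proof (cases x)
    case Zero
    then show ?thesis by (intro exI[of _ term_zero]) (simp add: G)
  next
    case (Base b)
    then show ?thesis using base assms by simp
  next
    case (Copy b)
    then have "Base b \<in> carrier G" using assms by (simp add: G)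
    then obtain q where "eval_term G (\<lambda>_. Base bt) q = Base b" using base by metis
    then have "x = eval_term G (\<lambda>_. Base bt) (Neg q)" by (simp add: Copy G)
    then show ?thesis by blast
  next
    case One
    then show ?thesis by (intro exI[of _ "Neg term_zero"]) (simp add: G)
  qed
qed

text \<open>At \<open>bt\<close>, the equations whose distances are joined in the \<open>i\<close>-th term all fail in \<open>M\<^sub>i\<close>, while
  each of the other five algebras satisfies at least one of them.\<close>

definition separating_terms :: "irl_term list" where
  "separating_terms =
     (let top = term_top X0; mid = term_mid X0; fix = term_fix X0; sq = Mult mid mid in
      [term_dist (term_imp top Unit) X0,
       Join (term_dist mid Unit) (term_dist (Meet Unit fix) X0),
       Join (term_dist mid top) (term_dist (term_imp mid Unit) X0),
       Join (term_dist sq mid) (term_dist (term_imp fix Unit) X0),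
       Join (term_dist sq top) (term_dist fix X0),
       Join (term_dist sq mid) (term_dist fix X0)])"

text \<open>A finite computation. Only the arguments \<open>e\<close> and \<bottom> are covered
  because the terms will be applied to values of \<open>term_nrm\<close>.\<close>

lemma eval_separating_terms:
  "list_all (\<lambda>i. list_all (\<lambda>j. \<forall>z\<in>{Base ee, Base bt}.
      eval_term ([M1, M2, M3, M4, M5, M6] ! j) (\<lambda>_. z) (separating_terms ! i) =
        (if i = j then z else Base ee)) [0..<6]) [0..<6]"
  by code_simp

lemma models_separated:
  assumes "G \<in> models"
  obtains p where "\<And>H z. H \<in> models \<Longrightarrow> z \<in> {Base ee, Base bt} \<Longrightarrow>
    eval_term H (\<lambda>_. z) p = Base ee \<or> H = G \<and> eval_term H (\<lambda>_. z) p = Base bt"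
    and "eval_term G (\<lambda>_. Base bt) p = Base bt"
proof -
  let ?M = "[M1, M2, M3, M4, M5, M6]"
  have M: "models = set ?M" by (simp add: models_def)
  have index: "\<exists>i<6. H = ?M ! i" if "H \<in> models" for H
  proof -
    obtain i where i: "i < length ?M" "?M ! i = H"
      using \<open>H \<in> models\<close> unfolding M in_set_conv_nth by (elim exE conjE)
    from i(1) have "i < 6" by simp
    then show ?thesis using i(2)[symmetric] by (intro exI[of _ i] conjI)
  qed
  then obtain i where i: "i < 6" "G = ?M ! i" using index[OF assms] by (elim exE conjE)
  have ev: "eval_term (?M ! j) (\<lambda>_. z) (separating_terms ! i) = (if i = j then z else Base ee)"
    if "j < 6" "z \<in> {Base ee, Base bt}" for j z
    by (rule eval_separating_terms[unfolded list_all_iff set_upt, rule_format])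
       (use i(1) that in simp_all)
  show thesis
  proof (rule that)
    fix H z assume "H \<in> models" and z: "z \<in> {Base ee, Base bt}"
    then obtain j where j: "j < 6" "H = ?M ! j" using index[OF \<open>H \<in> models\<close>] by (elim exE conjE)
    show "eval_term H (\<lambda>_. z) (separating_terms ! i) = Base ee \<or>
        H = G \<and> eval_term H (\<lambda>_. z) (separating_terms ! i) = Base bt"
      using ev[OF j(1) z] z i(2) unfolding j(2) by (cases "i = j") auto
  next
    show "eval_term G (\<lambda>_. Base bt) (separating_terms ! i) = Base bt"
      using ev[OF i(1), of "Base bt"] unfolding i(2) by simp
  qed
qed

section \<open>Finite subdirectly irreducible algebras\<close>

lemma subdirectly_irreducible_nontrivial:
  assumes "subdirectly_irreducible E" "irl_algebra E"
  obtains x where "x \<in> carrier E" "x \<noteq> \<one>\<^bsub>E\<^esub>"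
proof -
  \<comment> \<open>The empty family has the total congruence as its meet and does not contain the
    identity relation.\<close>
  have "carrier E \<times> carrier E \<noteq> Id_on (carrier E)"
    using assms(1)[unfolded subdirectly_irreducible_def, rule_format, of "{}"] by auto
  then obtain x y where "x \<in> carrier E" "y \<in> carrier E" "x \<noteq> y" by (auto simp: Id_on_def)
  then show thesis using that by (cases "x = \<one>\<^bsub>E\<^esub>") auto
qed

lemma finite_models: "finite models"
  by (simp add: models_def)

lemma finite_carrier_models: "G \<in> models \<Longrightarrow> finite (carrier G)"
  by (auto simp: models_def M_defs skew_carrier_def)

text \<open>If the common kernel of finitely many evaluations lies in the kernel of
  \<open>v\<close>, then already one of the kernels does. Otherwise the distances of two failing
  equations would join to \<open>e\<close> in \<open>E\<close>, against join-primeness.\<close>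

lemma kernel_contained_finite:
  fixes E :: "'a irl"
  assumes E: "in_generated_variety models E" and si: "subdirectly_irreducible E"
    and v: "range v = carrier E"
    and "finite W" "\<And>G w. (G, w) \<in> W \<Longrightarrow> G \<in> models"
    and "\<And>s t. (\<And>G w. (G, w) \<in> W \<Longrightarrow> eval_term G w s = eval_term G w t) \<Longrightarrow>
      eval_term E v s = eval_term E v t"
  shows "\<exists>(G, w)\<in>W. \<forall>s t. eval_term G w s = eval_term G w t \<longrightarrow> eval_term E v s = eval_term E v t"
  using assms(4-6)
proof (induction W rule: finite_induct)
  case empty
  obtain x where x: "x \<in> carrier E" "x \<noteq> \<one>\<^bsub>E\<^esub>"
    using subdirectly_irreducible_nontrivial[OF si irl_algebra_generated[OF E]] .
  then obtain n where "x = v n" using v by blast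
  \<comment> \<open>Over the empty set the hypothesis yields every equation, including
    \<open>x = e\<close>.\<close>
  then show ?case using empty(2)[of "Var n" Unit] x by simp
next
  case (insert Gw W)
  obtain G w where Gw: "Gw = (G, w)" by fastforce
  note vE = equalityD1[OF v]
  show ?case
  proof (rule ccontr)
    assume neg: "\<not> ?case"
    then obtain s t where st: "eval_term G w s = eval_term G w t"
      "eval_term E v s \<noteq> eval_term E v t" unfolding Gw by auto
    have "\<not> (\<forall>s t. (\<forall>G w. (G, w) \<in> W \<longrightarrow> eval_term G w s = eval_term G w t) \<longrightarrow>
      eval_term E v s = eval_term E v t)"
      using neg insert.IH insert.prems(1) by blast
    then obtain s' t' where st': "\<And>G w. (G, w) \<in> W \<Longrightarrow> eval_term G w s' = eval_term G w t'"
      "eval_term E v s' \<noteq> eval_term E v t'" by blast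
    let ?d = "term_dist s t" and ?d' = "term_dist s' t'"
    \<comment> \<open>At each pair of the enlarged set one of the two equations holds, so one
      distance is \<open>e\<close> and the join is \<open>e\<close>.\<close>
    have "eval_term E v (Join ?d ?d') = eval_term E v Unit"
    proof (rule insert.prems(2))
      fix H u assume Hu: "(H, u) \<in> insert Gw W"
      then have H: "H \<in> models" using insert.prems(1) by blast
      then obtain X T m where XT: "H = skew_model X T m" using models_cases by metis
      have same: "eval_term H u (term_dist s t) = Base ee" if "eval_term H u s = eval_term H u t" for s t
        using that by (simp add: eval_term_dist[OF H] skew_dist_def)
      consider "H = G" "u = w" | "(H, u) \<in> W" using Hu unfolding Gw by blast
      then have "eval_term H u ?d = Base ee \<or> eval_term H u ?d' = Base ee"
      proof cases
        case 1
        then show ?thesis using same[of s t] st(1) by simp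
      next
        case 2
        then show ?thesis using same[OF st'(1)] by simp
      qed
      then show "eval_term H u (Join ?d ?d') = eval_term H u Unit"
        using skew_sup_negative[OF eval_term_dist_cases[OF H, of u s t]
            eval_term_dist_cases[OF H, of u s' t'], of m]
        unfolding XT by auto
    qed
    then have "sup_op E (eval_term E v ?d) (eval_term E v ?d') = \<one>\<^bsub>E\<^esub>" by simp
    then have "eval_term E v ?d = \<one>\<^bsub>E\<^esub> \<or> eval_term E v ?d' = \<one>\<^bsub>E\<^esub>"
      using unit_join_prime[OF E si, of "eval_term E v ?d" "eval_term E v ?d'"]
        eval_term_in_carrier[OF irl_algebra_generated[OF E] vE]
      by (simp add: generated_dist(2)[OF E vE])
    then show False using st(2) st'(2) by (simp add: generated_dist(1)[OF E vE])
  qed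
qed

text \<open>An instance of Jonsson's lemma: \<open>E\<close> is a quotient of the subalgebra of \<open>G\<close> generated by
  the values of \<open>w\<close>.\<close>

lemma kernel_contained:
  fixes E :: "'a irl"
  assumes E: "in_generated_variety models E" and si: "subdirectly_irreducible E"
    and fin: "finite (carrier E)"
  obtains G w v where "G \<in> models" "range w \<subseteq> carrier G" "range v = carrier E"
    "\<And>s t. eval_term G w s = eval_term G w t \<Longrightarrow> eval_term E v s = eval_term E v t"
proof -
  have ne: "carrier E \<noteq> {}" using irl_algebra_generated[OF E] by (auto simp: irl_algebra_def)
  obtain N and f :: "nat \<Rightarrow> 'a" where f: "carrier E = f ` {i. i < N}"
    using finite_imp_nat_seg_image_inj_on[OF fin] by auto
  with ne have N: "N > 0" by (cases N) simp_all
  \<comment> \<open>Reducing indices modulo \<open>N\<close> leaves only \<open>N\<close>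
    independent variables, hence finitely many assignments into each model.\<close>
  define r where "r n = n mod N" for n
  have r: "r n < N" "r (r n) = r n" "i < N \<Longrightarrow> r i = i" for n i using N by (simp_all add: r_def)
  define v where "v = f \<circ> r"
  have "range r = {i. i < N}" using r(1) by (auto intro: r(3)[symmetric])
  then have v: "range v = carrier E" "v \<circ> r = v"
    unfolding v_def image_comp[symmetric] by (simp_all add: f r(2) fun_eq_iff)
  define W where "W = (\<Union>G\<in>models. (\<lambda>u. (G, u \<circ> r)) ` (\<Pi>\<^sub>E i\<in>{..<N}. carrier G))"
  have fW: "finite W" unfolding W_def
    by (intro finite_UN_I finite_models finite_imageI finite_PiE) (auto simp: finite_carrier_models)
  have W: "G \<in> models \<and> range w \<subseteq> carrier G" if Gw: "(G, w) \<in> W" for G w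
  proof -
    obtain u where u: "G \<in> models" "w = u \<circ> r" "u \<in> (\<Pi>\<^sub>E i\<in>{..<N}. carrier G)"
      using Gw unfolding W_def by auto
    then show ?thesis using r(1) by (auto dest: PiE_mem)
  qed
  have ker: "eval_term E v s = eval_term E v t"
    if st: "\<And>G w. (G, w) \<in> W \<Longrightarrow> eval_term G w s = eval_term G w t" for s t
  proof -
    \<comment> \<open>With reduced variables, an equation valid on \<open>W\<close> is an identity
      of all models, since every \<open>w \<circ> r\<close> occurs in \<open>W\<close>;
      \<open>v\<close> is unchanged by \<open>r\<close>.\<close>
    have "eval_term E v (subst_term (Var \<circ> r) s) = eval_term E v (subst_term (Var \<circ> r) t)"
    proof (rule identity_transfer[OF E])
      fix G and w :: "nat \<Rightarrow> dunn_elem skew"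
      assume G: "G \<in> models" and w: "range w \<subseteq> carrier G"
      have "w \<circ> r = restrict w {..<N} \<circ> r" using r by (auto simp: fun_eq_iff)
      moreover have "restrict w {..<N} \<in> (\<Pi>\<^sub>E i\<in>{..<N}. carrier G)" using w by auto
      ultimately have "(G, w \<circ> r) \<in> W" unfolding W_def using G by blast
      from st[OF this]
      show "eval_term G w (subst_term (Var \<circ> r) s) = eval_term G w (subst_term (Var \<circ> r) t)"
        by (simp add: eval_subst_term comp_def)
    qed (simp add: v(1))
    moreover have "eval_term E v (subst_term (Var \<circ> r) t) = eval_term E (v \<circ> r) t" for t
      by (simp add: eval_subst_term comp_def)
    ultimately show ?thesis by (simp only: v(2))
  qed
  have "\<exists>(G, w)\<in>W. \<forall>s t. eval_term G w s = eval_term G w t \<longrightarrow>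
      eval_term E v s = eval_term E v t"
    by (rule kernel_contained_finite[OF E si v(1) fW W[THEN conjunct1] ker])
  then obtain G w where Gw: "(G, w) \<in> W"
    "\<And>s t. eval_term G w s = eval_term G w t \<Longrightarrow> eval_term E v s = eval_term E v t"
    by blast
  show thesis by (rule that[OF _ _ v(1) Gw(2)]) (use W[OF Gw(1)] in simp_all)
qed

lemma collapse_collapse: "collapse (collapse x) = collapse x"
  by (cases x) auto

lemma range_collapse: "x \<in> range collapse \<longleftrightarrow> collapse x = x"
proof
  assume "x \<in> range collapse"
  then show "collapse x = x" by (elim imageE) (simp add: collapse_collapse)
next
  assume "collapse x = x"
  then show "x \<in> range collapse" by (intro image_eqI[of _ _ x]) simp_all
qed

text \<open>If an equation between constants held in \<open>E\<close> but failed in one model, its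
  distance would be \<open>0\<close> in all models, since collapsing carries the constants of one
  model to those of any other. Then \<open>e = 0\<close> in \<open>E\<close>, making
  \<open>E\<close> trivial.\<close>

lemma projective_if_unit_generated:
  fixes E :: "'a irl"
  assumes E: "in_generated_variety models E" and si: "subdirectly_irreducible E"
    and gen: "\<And>x. x \<in> carrier E \<Longrightarrow> \<exists>q. x = eval_term E (\<lambda>_. \<one>\<^bsub>E\<^esub>) q"
  shows "projective_in_generated_variety TYPE('b) models E"
proof (rule projective_if_generated[OF E _ gen, where p = Unit])
  note algE = irl_algebra_generated[OF E]
  show one: "\<one>\<^bsub>E\<^esub> \<in> carrier E" by (rule generated_closed[OF E])
  fix q r G and w :: "nat \<Rightarrow> dunn_elem skew"
  assume qr: "eval_term E (\<lambda>_. \<one>\<^bsub>E\<^esub>) q = eval_term E (\<lambda>_. \<one>\<^bsub>E\<^esub>) r" and G: "G \<in> models"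
  have ev: "eval_term H (\<lambda>_. Base ee) t = collapse (eval_term G (\<lambda>_. Base ee) t)"
    if "H \<in> models" for H t
    using collapse_eval_term[OF G that, of "\<lambda>_. Base ee" t] by (simp add: comp_def)
  show "eval_term G (\<lambda>_. eval_term G w Unit) q = eval_term G (\<lambda>_. eval_term G w Unit) r"
  proof (rule ccontr)
    assume "\<not> ?thesis"
    then have ne: "eval_term G (\<lambda>_. Base ee) q \<noteq> eval_term G (\<lambda>_. Base ee) r"
      by (simp add: models_eval_unit[OF G])
    \<comment> \<open>Closed terms, whose values do not depend on the assignment.\<close>
    let ?q = "subst_term (\<lambda>_. Unit) q" and ?r = "subst_term (\<lambda>_. Unit) r"
    have zero: "eval_term H u term_zero = Zero" "Zero \<otimes>\<^bsub>H\<^esub> y = Zero"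
      if "H \<in> models" for H u y
      using that by (auto elim!: models_cases)
    obtain x where x: "x \<in> carrier E" "x \<noteq> \<one>\<^bsub>E\<^esub>"
      using subdirectly_irreducible_nontrivial[OF si algE] .
    then have v: "range (\<lambda>_::nat. x) \<subseteq> carrier E" by auto
    have "eval_term E (\<lambda>_. x) (term_dist ?q ?r) = eval_term E (\<lambda>_. x) term_zero"
    proof (rule identity_transfer[OF E _ v])
      fix H and u :: "nat \<Rightarrow> dunn_elem skew" assume H: "H \<in> models"
      have "collapse (eval_term G (\<lambda>_. Base ee) q) \<noteq> collapse (eval_term G (\<lambda>_. Base ee) r)"
        using ne unfolding ev[OF G, symmetric] .
      then have "collapse (eval_term H (\<lambda>_. Base ee) q) \<noteq> collapse (eval_term H (\<lambda>_. Base ee) r)"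
        by (simp add: ev[OF H, of q] ev[OF H, of r] collapse_collapse)
      moreover from this have "eval_term H (\<lambda>_. Base ee) q \<noteq> eval_term H (\<lambda>_. Base ee) r" by auto
      ultimately show "eval_term H u (term_dist ?q ?r) = eval_term H u term_zero"
        unfolding eval_term_dist[OF H] zero(1)[OF H]
        by (simp add: eval_subst_term models_eval_unit[OF H] skew_dist_def)
    qed
    moreover have "eval_term E (\<lambda>_. x) (term_dist ?q ?r) = \<one>\<^bsub>E\<^esub>"
      using qr by (simp add: generated_dist(1)[OF E v] eval_subst_term)
    moreover have "eval_term E (\<lambda>_. x) (Mult term_zero X0) = eval_term E (\<lambda>_. x) term_zero"
      by (rule identity_transfer[OF E _ v]) (simp only: eval_term.simps(4)[of _ _ term_zero] zero)
    ultimately have "\<one>\<^bsub>E\<^esub> \<otimes>\<^bsub>E\<^esub> x = \<one>\<^bsub>E\<^esub>" by simp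
    then show False using x by (simp add: generated_unit[OF E])
  qed
qed simp_all

lemma projective_if_finite_subdirectly_irreducible:
  fixes E :: "'a irl"
  assumes E: "in_generated_variety models E" and fin: "finite (carrier E)"
    and si: "subdirectly_irreducible E"
  shows "projective_in_generated_variety TYPE('b) models E"
proof -
  obtain G w v where G: "G \<in> models" and w: "range w \<subseteq> carrier G" and v: "range v = carrier E"
    and ker: "\<And>s t. eval_term G w s = eval_term G w t \<Longrightarrow> eval_term E v s = eval_term E v t"
    using kernel_contained[OF E si fin] by blast
  note vE = equalityD1[OF v]
  have terms: "\<exists>t. x = eval_term E v t" if "x \<in> carrier E" for x
    using that v by (metis imageE eval_term.simps(1))
  obtain X T m where XT: "G = skew_model X T m" using G models_cases by metis
  have sup: "sup_op G x y = skew_sup m x y" for x y by (simp add: XT)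
  show ?thesis
  \<comment> \<open>The first case is that the values of \<open>w\<close> generate only
    constants.\<close>
  proof (cases "\<forall>t. eval_term G w t \<in> range collapse")
    case True
    show ?thesis
    proof (rule projective_if_unit_generated[OF E si])
      fix x assume "x \<in> carrier E"
      then obtain t where t: "x = eval_term E v t" using terms by metis
      let ?C = "{term_zero, Neg term_zero, Unit, Neg Unit}"
      have "collapse (eval_term G w t) = eval_term G w t" using True range_collapse by blast
      then have "\<exists>q\<in>?C. eval_term G w t = eval_term G w q"
        by (cases "eval_term G w t") (auto simp: XT)
      then obtain q where "q \<in> ?C" "x = eval_term E v q" using ker t by blast
      then show "\<exists>q. x = eval_term E (\<lambda>_. \<one>\<^bsub>E\<^esub>) q"
        by (intro exI[of _ q]) auto
    qed
  next
    case False
    then obtain t0 where t0: "eval_term G w t0 \<notin> range collapse" by blast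
    \<comment> \<open>Normalising a value that is not a constant produces \<bottom>, which generates
      all of \<open>G\<close>; so the image \<open>b\<close> of \<bottom> generates
      \<open>E\<close>.\<close>
    define \<beta> where "\<beta> = term_nrm t0"
    have \<beta>: "eval_term G w \<beta> = Base bt" using t0 by (simp add: \<beta>_def eval_term_nrm[OF G])
    define b where "b = eval_term E v \<beta>"
    have b: "b \<in> carrier E"
      unfolding b_def by (rule eval_term_in_carrier[OF irl_algebra_generated[OF E] vE])
    have gen: "\<exists>q. x = eval_term E (\<lambda>_. b) q" if x: "x \<in> carrier E" for x
    proof -
      obtain t where t: "x = eval_term E v t" using terms[OF x] by blast
      obtain q where "eval_term G w t = eval_term G (\<lambda>_. Base bt) q"
        using models_generated[OF G models_eval_in_carrier[OF G w]] by blast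
      then have "eval_term G w t = eval_term G w (subst_term (\<lambda>_. \<beta>) q)"
        by (simp add: eval_subst_term \<beta>)
      from ker[OF this] show ?thesis by (auto simp: t eval_subst_term b_def)
    qed
    show ?thesis
    proof (cases "b = \<one>\<^bsub>E\<^esub>")
      case True
      then show ?thesis using gen by (intro projective_if_unit_generated[OF E si]) simp
    next
      case b1: False
      obtain p where sep: "\<And>H z. H \<in> models \<Longrightarrow> z \<in> {Base ee, Base bt} \<Longrightarrow>
          eval_term H (\<lambda>_. z) p = Base ee \<or> H = G \<and> eval_term H (\<lambda>_. z) p = Base bt"
        and p: "eval_term G (\<lambda>_. Base bt) p = Base bt"
        by (rule models_separated[OF G]) blast
      \<comment> \<open>Normalising first confines the argument of \<open>p\<close> to
        \<open>e\<close> and \<bottom>, for which \<open>sep\<close> describes its values.\<close>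
      define P where "P = subst_term (\<lambda>_. term_nrm X0) p"
      \<comment> \<open>\<open>E\<close> is a copy of \<open>G\<close>: identifying two distinct
        elements would send a distance \<open>d\<close> of \<bottom> or \<open>0\<close> to
        \<open>e\<close>, and \<open>d \<or> \<bottom> = \<bottom>\<close> would give
        \<open>e \<or> b = b\<close>, hence \<open>b = e\<close>.\<close>
      have inj: "eval_term G (\<lambda>_. Base bt) q = eval_term G (\<lambda>_. Base bt) r"
        if "eval_term E (\<lambda>_. b) q = eval_term E (\<lambda>_. b) r" for q r
      proof (rule ccontr)
        assume ne: "\<not> ?thesis"
        let ?d = "term_dist (subst_term (\<lambda>_. \<beta>) q) (subst_term (\<lambda>_. \<beta>) r)"
        have d: "eval_term E v ?d = \<one>\<^bsub>E\<^esub>"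
          using that by (simp add: generated_dist(1)[OF E vE] eval_subst_term b_def)
        have "eval_term G w ?d \<in> {Base bt, Zero}"
          using ne by (simp add: eval_term_dist[OF G] eval_subst_term \<beta> skew_dist_def)
        then have "eval_term G w (Join ?d \<beta>) = eval_term G w \<beta>"
          by (auto simp: \<beta> sup skew_sup_negative)
        then have "sup_op E \<one>\<^bsub>E\<^esub> b = b" using ker[of "Join ?d \<beta>" \<beta>] d by (simp add: b_def)
        moreover have "eval_term G w (Join Unit \<beta>) = eval_term G w Unit"
          by (simp add: \<beta> sup skew_sup_negative models_eval_unit[OF G])
        then have "sup_op E \<one>\<^bsub>E\<^esub> b = \<one>\<^bsub>E\<^esub>" using ker[of "Join Unit \<beta>" Unit] by (simp add: b_def)
        ultimately show False using b1 by simp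
      qed
      show ?thesis
      proof (rule projective_if_generated[OF E b gen, where p = P])
        have "eval_term G w (subst_term (\<lambda>_. \<beta>) P) = eval_term G w \<beta>"
          by (simp add: P_def eval_subst_term eval_term_nrm[OF G] range_collapse p \<beta>)
        from ker[OF this] show "eval_term E (\<lambda>_. b) P = b"
          by (simp add: eval_subst_term b_def)
      next
        fix q r H and u :: "nat \<Rightarrow> dunn_elem skew"
        assume qr: "eval_term E (\<lambda>_. b) q = eval_term E (\<lambda>_. b) r" and H: "H \<in> models"
        define z where "z = eval_term H u (term_nrm X0)"
        have z: "z \<in> {Base ee, Base bt}" unfolding z_def eval_term_nrm[OF H] by simp
        have Pz: "eval_term H u P = eval_term H (\<lambda>_. z) p"
          by (simp add: P_def eval_subst_term z_def)
        consider "eval_term H u P = Base ee" | "H = G" "eval_term H u P = Base bt"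
          using sep[OF H z] unfolding Pz by (elim disjE conjE)
        then show "eval_term H (\<lambda>_. eval_term H u P) q = eval_term H (\<lambda>_. eval_term H u P) r"
        proof cases
          case 1
          \<comment> \<open>Collapsing sends \<bottom> in \<open>G\<close> to \<open>e\<close> in
            \<open>H\<close>, so equations true of \<bottom> in \<open>G\<close> also hold of
            \<open>e\<close> in \<open>H\<close>.\<close>
          have "eval_term H (\<lambda>_. Base ee) t = collapse (eval_term G (\<lambda>_. Base bt) t)" for t
            using collapse_eval_term[OF G H, of "\<lambda>_. Base bt" t] by (simp add: comp_def)
          then show ?thesis using 1 inj[OF qr] by simp
        next
          case 2
          then show ?thesis using inj[OF qr] by simp
        qed
      qed
    qed
  qed
qed

theorem theorem8p12:
  fixes E :: "'a irl"
  assumes "in_generated_variety {G1, G2, G3, G4, G5, G6} E"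
    and "finite (carrier E)"
    and "subdirectly_irreducible E"
  shows "projective_in_generated_variety TYPE('b) {G1, G2, G3, G4, G5, G6} E"
  using projective_if_finite_subdirectly_irreducible[where 'b = 'b and E = E] assms
  by (simp add: projective_in_generated_variety_def in_generated_variety_models)

end
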